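(* Let $p\in\mathcal{H}_{n,d}(e)$, i.e. $p$ is a real homogeneous polynomial of degree $d$ in $n$ variables that is hyperbolic with respect to $e\in\mathbb{R}^n$. Then $$\mathrm{relint}(\Lambda_+(p,e)^* )\subseteq\phi_{p,e}(\mathbb{R}^n,\mathbb{R}^d)\subseteq\Lambda_+(p,e)^*,$$ where $\mathrm{relint}$ denotes relative interior.
   Context: A homogeneous polynomial $p\in\mathbb{R}[x_1,\ldots,x_n]$ of degree $d$ is hyperbolic with respect to $e\in\mathbb{R}^n$ if $p(e)>0$ and for every $x\in\mathbb{R}^n$ the polynomial $t\mapsto p(x+te)$ has only real zeros; $\mathcal{H}_{n,d}(e)$ is the set of such polynomials. The hyperbolicity cone $\Lambda_+(p,e)$ is the set of $x\in\mathbb{R}^n$ such that all zeros of $t\mapsto p(te-x)$ are nonnegative. Its dual cone is $\Lambda_+(p,e)^*=\{\xi\in(\mathbb{R}^n)^*:\xi[x]\ge0\text{ for all }x\in\Lambda_+(p,e)\}$. For $x,u\in\mathbb{R}^n$ put $p_x(t)=p(x+te)$ and $D_up_x(t)=(D_up)(x+te)$, with $D_u$ the directional derivative. The parameterized Hermite matrix $H_{p,e}(x)[u]$ is the $d\times d$ Hankel matrix $[h_{i+j-1}]_{i,j=1}^d$, where $\frac{D_up_x(t)}{p_x(t)}=\sum_{k\ge1}h_kt^{-k}$ (expansion at infinity); it is linear in $u$. For $(x,y)\in\mathbb{R}^n\times\mathbb{R}^d$, $\phi_{p,e}(x,y)\in(\mathbb{R}^n)^*$ is the linear functional $\phi_{p,e}(x,y)[u]=y^TH_{p,e}(x)[u]\,y$,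 and $\phi_{p,e}(\mathbb{R}^n,\mathbb{R}^d)=\{\phi_{p,e}(x,y):x\in\mathbb{R}^n,\ y\in\mathbb{R}^d\}$. *)

theory Defs
  imports
    "HOL-Analysis.Analysis"
    "HOL-Computational_Algebra.Formal_Laurent_Series"
    "Jordan_Normal_Form.Matrix"
begin

text \<open>
  Polynomials in the coordinates of \<open>real ^ 'n\<close> are represented by the functions they induce;
  over the reals this loses nothing.
\<close>

definition homogeneous_poly :: "nat \<Rightarrow> (real ^ 'n \<Rightarrow> real) \<Rightarrow> bool" where
  "homogeneous_poly d p \<longleftrightarrow>
     (\<exists>c :: ('n \<Rightarrow> nat) \<Rightarrow> real.
        \<forall>x. p x = (\<Sum>\<alpha> | (\<Sum>i\<in>UNIV. \<alpha> i) = d. c \<alpha> * (\<Prod>i\<in>UNIV. vec_nth x i ^ \<alpha> i)))"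

lemma finite_multi_indices: "finite {\<alpha> :: 'n::finite \<Rightarrow> nat. (\<Sum>i\<in>UNIV. \<alpha> i) = d}"
proof (rule finite_subset)
  show "{\<alpha> :: 'n \<Rightarrow> nat. (\<Sum>i\<in>UNIV. \<alpha> i) = d} \<subseteq> PiE UNIV (\<lambda>_. {..d})"
    by (auto simp: PiE_UNIV_domain intro: member_le_sum)
  show "finite (PiE (UNIV :: 'n set) (\<lambda>_. {..d}))"
    by (intro finite_PiE) auto
qed

text \<open>
  For a polynomial function \<open>f\<close>, the univariate polynomial \<open>t \<mapsto> f (x + t e)\<close>.
\<close>

definition line_poly :: "(real ^ 'n \<Rightarrow> real) \<Rightarrow> real ^ 'n \<Rightarrow> real ^ 'n \<Rightarrow> real poly" where
  "line_poly f x e = (THE q. \<forall>t. poly q t = f (x + t *\<^sub>R e))"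

lemma poly_line_poly:
  assumes "homogeneous_poly d p"
  shows "poly (line_poly p x e) t = p (x + t *\<^sub>R e)"
proof -
  obtain c where p: "\<And>x. p x = (\<Sum>\<alpha> | (\<Sum>i\<in>UNIV. \<alpha> i) = d. c \<alpha> * (\<Prod>i\<in>UNIV. vec_nth x i ^ \<alpha> i))"
    using assms unfolding homogeneous_poly_def by blast
  have "\<exists>!q. \<forall>t. poly q t = p (x + t *\<^sub>R e)"
  proof (rule ex_ex1I)
    have "\<forall>t. poly (\<Sum>\<alpha> | (\<Sum>i\<in>UNIV. \<alpha> i) = d.
                Polynomial.smult (c \<alpha>) (\<Prod>i\<in>UNIV. [:vec_nth x i, vec_nth e i:] ^ \<alpha> i)) t
              = p (x + t *\<^sub>R e)"
      by (simp add: p poly_sum poly_prod)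
    then show "\<exists>q. \<forall>t. poly q t = p (x + t *\<^sub>R e)" ..
  qed (metis poly_eq_poly_eq_iff ext)
  from theI'[OF this] show ?thesis
    unfolding line_poly_def by blast
qed

definition hyperbolic_polys :: "nat \<Rightarrow> real ^ 'n \<Rightarrow> (real ^ 'n \<Rightarrow> real) set" where
  "hyperbolic_polys d e =
     {p. homogeneous_poly d p \<and> p e > 0 \<and>
         (\<forall>x. \<forall>z::complex. poly (map_poly complex_of_real (line_poly p x e)) z = 0 \<longrightarrow> z \<in> \<real>)}"

text \<open>
  The zeros of \<open>t \<mapsto> p (t e - x)\<close> are real for hyperbolic \<open>p\<close>, so \<open>t\<close> ranges over the reals.
\<close>

definition hyperbolicity_cone :: "(real ^ 'n \<Rightarrow> real) \<Rightarrow> real ^ 'n \<Rightarrow> (real ^ 'n) set" where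
  "hyperbolicity_cone p e = {x. \<forall>t::real. p (t *\<^sub>R e - x) = 0 \<longrightarrow> t \<ge> 0}"

definition dual_cone :: "'a::real_normed_vector set \<Rightarrow> ('a \<Rightarrow>\<^sub>L real) set" where
  "dual_cone K = {\<xi>. \<forall>x\<in>K. blinfun_apply \<xi> x \<ge> 0}"

definition directional_deriv ::
    "(real ^ 'n \<Rightarrow> real) \<Rightarrow> real ^ 'n \<Rightarrow> real ^ 'n \<Rightarrow> real" where
  "directional_deriv p u = (\<lambda>z. frechet_derivative p (at z) u)"

text \<open>
  The expansion of \<open>f(t) / g(t)\<close> at infinity, as a formal Laurent series in the variable
  \<open>t\<inverse>\<close>: \<open>fls_X\<close> plays the role of \<open>t\<inverse>\<close>, hence \<open>fls_X_inv\<close> that of \<open>t\<close>.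
\<close>

definition expansion_at_infinity :: "real poly \<Rightarrow> real poly \<Rightarrow> real fls" where
  "expansion_at_infinity f g =
     poly (map_poly fls_const f) fls_X_inv / poly (map_poly fls_const g) fls_X_inv"

definition hermite_coeff ::
    "(real ^ 'n \<Rightarrow> real) \<Rightarrow> real ^ 'n \<Rightarrow> real ^ 'n \<Rightarrow> real ^ 'n \<Rightarrow> nat \<Rightarrow> real" where
  "hermite_coeff p e x u k =
     fls_nth (expansion_at_infinity (line_poly (directional_deriv p u) x e) (line_poly p x e))
       (int k)"

text \<open>
  Matrix indices start at 0, so the entry \<open>h\<^bsub>i+j-1\<^esub>\<close> of the 1-based convention becomes
  \<open>h\<^bsub>i+j+1\<^esub>\<close>.
\<close>

definition hermite_matrix ::
    "nat \<Rightarrow> (real ^ 'n \<Rightarrow> real) \<Rightarrow> real ^ 'n \<Rightarrow> real ^ 'n \<Rightarrow> real ^ 'n \<Rightarrow> real mat" where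
  "hermite_matrix d p e x u = mat d d (\<lambda>(i, j). hermite_coeff p e x u (i + j + 1))"

text \<open>
  For hyperbolic \<open>p\<close> the argument of \<open>Blinfun\<close> is linear in \<open>u\<close>, because the directional
  derivative is; boundedness is then automatic in finite dimension.
\<close>

definition hermite_functional ::
    "nat \<Rightarrow> (real ^ 'n \<Rightarrow> real) \<Rightarrow> real ^ 'n \<Rightarrow> real ^ 'n \<Rightarrow> real vec \<Rightarrow> (real ^ 'n) \<Rightarrow>\<^sub>L real" where
  "hermite_functional d p e x y =
     Blinfun (\<lambda>u. scalar_prod y (hermite_matrix d p e x u *\<^sub>v y))"

end

theory Submission
  imports Defs "HOL-Computational_Algebra.Fundamental_Theorem_Algebra"
begin

text \<open>
  Fix \<open>x\<close> and consider the rational function \<open>R\<^sub>u(t) = D\<^sub>u p (x + t e) / p (x + t e)\<close>.  Everything rests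
  on its partial fraction decomposition
  \<open>R\<^sub>u(t) = (\<Sum>a. k\<^sub>a(u) / (t - a))\<close> over the distinct zeros \<open>a\<close> of \<open>t \<mapsto> p (x + t e)\<close>: all poles are simple,
  and \<open>k\<^sub>a(u) \<ge> 0\<close> when \<open>u\<close> is in the hyperbolicity cone (\<open>hermite_residues\<close>).  Expanding at infinity gives
  \<open>h\<^sub>k = (\<Sum>a. k\<^sub>a(u) a\<^bsup>k-1\<^esup>)\<close>, so that
  \<open>\<phi>(x, y)[u] = (\<Sum>a. k\<^sub>a(u) Y(a)\<^sup>2)\<close>, where \<open>Y\<close> is the polynomial with coefficient vector \<open>y\<close>.

  The decomposition follows from stability: for \<open>u\<close> in the open cone, \<open>p (x + t e + s u) \<noteq> 0\<close> whenever
  \<open>Im t > 0\<close> and \<open>Im s \<ge> 0\<close> (\<open>pC_stable\<close>).  This is Garding's argument: deforming \<open>x\<close> to \<open>0\<close>, zeros \<open>s\<close> never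
  cross the real axis, and at \<open>x = 0\<close> they lie in the lower half plane by homogeneity.  Hence, for fixed \<open>t\<close>
  in the upper half plane, \<open>R\<^sub>u(t)\<close> is the logarithmic derivative at \<open>s = 0\<close> of a polynomial with all its
  zeros in the lower half plane, and so \<open>Im R\<^sub>u(t) \<le> 0\<close>.  A real rational function that maps the upper half
  plane into the closed lower one has only simple poles, with nonnegative residues
  (\<open>partial_fractions_of_Im_nonpos\<close>).

  The inclusion in the dual cone is now immediate, by passing from the open cone to its closure.  For the
  other inclusion, let \<open>\<xi>\<close> be in the relative interior of the dual cone and \<open>d > 0\<close>.

  \<^item> Modulo the common kernel of the dual cone, along which \<open>p\<close> is constant, \<open>\<xi>\<close> is positive on the
    nonzero elements of the cone.  Hence \<open>p\<close> attains its maximum on the slice \<open>\<xi> = 1\<close>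
    of the cone, at a point \<open>x\<close> of the open cone, where the multiplier rule reads
    \<open>D\<^sub>u p (x) = d p(x) \<xi>[u]\<close> (\<open>rel_interior_dual_cone_gradient\<close>).

  \<^item> At such an \<open>x\<close> all zeros \<open>a\<close> are negative, so there is a \<open>Y\<close> of degree less than \<open>d\<close> with
    \<open>Y(a)\<^sup>2 = - 1 / (d a)\<close>.  For this \<open>Y\<close> the formula above gives
    \<open>\<phi>(x, y)[u] = R\<^sub>u(0) / d = \<xi>[u]\<close> (\<open>gradient_in_hermite_image\<close>).
\<close>

section \<open>Forms, their derivatives, and their restrictions to lines\<close>

text \<open>
  The homogeneous polynomial of degree \<open>d\<close> with real coefficients \<open>c\<close>, evaluated at a point \<open>w\<close> of a
  commutative ring; \<open>\<kappa>\<close> maps the coefficients into that ring.  The rings used are the reals, the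
  complex numbers, and univariate polynomials over either; the last give restrictions to lines.
\<close>

definition form :: "(real \<Rightarrow> 'a) \<Rightarrow> nat \<Rightarrow> (('n::finite \<Rightarrow> nat) \<Rightarrow> real) \<Rightarrow> ('n \<Rightarrow> 'a::comm_ring_1) \<Rightarrow> 'a" where
  "form \<kappa> d c w = (\<Sum>\<alpha> | (\<Sum>i\<in>UNIV. \<alpha> i) = d. \<kappa> (c \<alpha>) * (\<Prod>i\<in>UNIV. w i ^ \<alpha> i))"

text \<open>
  The directional derivative of that polynomial at \<open>w\<close> in the direction \<open>v\<close>.  The truncated exponent
  \<open>\<alpha> i - 1\<close> at \<open>\<alpha> i = 0\<close> is harmless because of the factor \<open>\<alpha> i\<close>.
\<close>

definition dform :: "(real \<Rightarrow> 'a) \<Rightarrow> nat \<Rightarrow> (('n::finite \<Rightarrow> nat) \<Rightarrow> real) \<Rightarrow> ('n \<Rightarrow> 'a::comm_ring_1) \<Rightarrow> ('n \<Rightarrow> 'a) \<Rightarrow> 'a" where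
  "dform \<kappa> d c w v = (\<Sum>\<alpha> | (\<Sum>i\<in>UNIV. \<alpha> i) = d. \<kappa> (c \<alpha>) *
     (\<Sum>i\<in>UNIV. of_nat (\<alpha> i) * v i * w i ^ (\<alpha> i - 1) * (\<Prod>j\<in>UNIV - {i}. w j ^ \<alpha> j)))"

lemma form_scale: "form \<kappa> d c (\<lambda>i. k * w i) = k ^ d * form \<kappa> d c w"
  unfolding form_def sum_distrib_left
  by (intro sum.cong refl) (auto simp: power_mult_distrib prod.distrib power_sum algebra_simps)

lemma form_of_real:
  "form of_real d c (\<lambda>i. of_real (w i)) = (of_real (form of_real d c w) :: 'a::{real_algebra_1,comm_ring_1})"
  by (simp add: form_def)

lemma dform_of_real:
  "dform of_real d c (\<lambda>i. of_real (w i)) (\<lambda>i. of_real (v i))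
     = (of_real (dform of_real d c w v) :: 'a::{real_algebra_1,comm_ring_1})"
  by (simp add: dform_def)

lemma poly_form: "poly (form (\<lambda>r. [:\<kappa> r:]) d c w) t = form \<kappa> d c (\<lambda>i. poly (w i) t)"
  by (simp add: form_def poly_sum poly_prod)

lemma poly_dform:
  "poly (dform (\<lambda>r. [:\<kappa> r:]) d c w v) t = dform \<kappa> d c (\<lambda>i. poly (w i) t) (\<lambda>i. poly (v i) t)"
  by (simp add: dform_def poly_sum poly_prod)

lemma pderiv_form:
  fixes w :: "'n::finite \<Rightarrow> 'a::idom poly"
  shows "pderiv (form (\<lambda>r. [:\<kappa> r:]) d c w) = dform (\<lambda>r. [:\<kappa> r:]) d c w (\<lambda>i. pderiv (w i))"
proof -
  have "pderiv (Polynomial.smult k (\<Prod>i\<in>UNIV. w i ^ \<alpha> i)) =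
        Polynomial.smult k (\<Sum>i\<in>UNIV. of_nat (\<alpha> i) * pderiv (w i) * w i ^ (\<alpha> i - 1) * (\<Prod>j\<in>UNIV - {i}. w j ^ \<alpha> j))"
    for k and \<alpha> :: "'n \<Rightarrow> nat"
    unfolding pderiv_smult pderiv_prod pderiv_power
    by (intro arg_cong[where f = "Polynomial.smult k"] sum.cong refl) (simp add: of_nat_poly algebra_simps)
  then show ?thesis
    by (simp add: form_def dform_def higher_pderiv_sum[of 1, simplified])
qed

lemma dform_add: "dform \<kappa> d c w (\<lambda>i. u i + v i) = dform \<kappa> d c w u + dform \<kappa> d c w v"
  by (simp add: dform_def algebra_simps sum.distrib)

lemma dform_scale: "dform \<kappa> d c w (\<lambda>i. k * v i) = k * dform \<kappa> d c w v"
  by (simp add: dform_def sum_distrib_left algebra_simps)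

lemma dform_degree_0: "dform \<kappa> 0 c w v = 0"
  by (simp add: dform_def)

lemma continuous_on_form [continuous_intros]:
  fixes f :: "'b::topological_space \<Rightarrow> 'n::finite \<Rightarrow> 'a::{real_normed_algebra_1,comm_ring_1}"
  assumes "\<And>i. continuous_on S (\<lambda>x. f x i)"
  shows "continuous_on S (\<lambda>x. form of_real d c (f x))"
  unfolding form_def by (intro continuous_intros assms)

lemma has_derivative_form:
  "((\<lambda>z :: real ^ 'n. form of_real d c (vec_nth z)) has_derivative
     (\<lambda>u. dform of_real d c (vec_nth z) (vec_nth u))) (at z)"
proof -
  have pow: "((\<lambda>z :: real ^ 'n. vec_nth z i ^ k) has_derivative
      (\<lambda>u. of_nat k * vec_nth u i * vec_nth z i ^ (k - 1))) (at z)" for i k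
    by (rule has_derivative_power, rule bounded_linear_imp_has_derivative, rule bounded_linear_vec_nth)
  have prod: "((\<lambda>z :: real ^ 'n. \<Prod>i\<in>UNIV. vec_nth z i ^ \<alpha> i) has_derivative
      (\<lambda>u. \<Sum>i\<in>UNIV. of_nat (\<alpha> i) * vec_nth u i * vec_nth z i ^ (\<alpha> i - 1) *
        (\<Prod>j\<in>UNIV - {i}. vec_nth z j ^ \<alpha> j))) (at z)" for \<alpha>
    by (rule has_derivative_prod[of UNIV "\<lambda>i z. vec_nth z i ^ \<alpha> i"
          "\<lambda>i u. of_nat (\<alpha> i) * vec_nth u i * vec_nth z i ^ (\<alpha> i - 1)", OF pow])
  show ?thesis
    unfolding form_def dform_def of_real_eq_id id_apply
    by (rule has_derivative_sum, rule has_derivative_mult_right, rule prod)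
qed

lemma coeff_mult_degree_le:
  fixes p q :: "'a::comm_ring_1 poly"
  assumes "degree p \<le> m" "degree q \<le> n"
  shows "coeff (p * q) (m + n) = coeff p m * coeff q n"
proof -
  have "(\<Sum>i\<le>m + n. coeff p i * coeff q (m + n - i)) = (\<Sum>i\<in>{m}. coeff p i * coeff q (m + n - i))"
  proof (rule sum.mono_neutral_right)
    have "i < m \<Longrightarrow> coeff q (m + n - i) = 0" for i
      by (rule coeff_eq_0) (use assms in linarith)
    moreover have "i > m \<Longrightarrow> coeff p i = 0" for i
      by (rule coeff_eq_0) (use assms in linarith)
    ultimately show "\<forall>i\<in>{..m + n} - {m}. coeff p i * coeff q (m + n - i) = 0"
      by (metis DiffD2 mult_zero_left mult_zero_right nat_neq_iff singletonI)
  qed auto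
  then show ?thesis by (simp add: coeff_mult)
qed

lemma degree_prod_le_sum:
  assumes "finite A" "\<And>i. i \<in> A \<Longrightarrow> degree (f i) \<le> b i"
  shows "degree (\<Prod>i\<in>A. f i) \<le> (\<Sum>i\<in>A. b i)"
  by (rule order_trans[OF degree_prod_sum_le[OF assms(1)]]) (use assms in \<open>auto intro: sum_mono\<close>)

lemma degree_linear_power_le: "degree ([:a, b:] ^ n) \<le> n"
  by (rule order_trans[OF degree_power_le]) (auto split: if_splits)

lemma coeff_linear_power_top: "coeff ([:a, b:] ^ n) n = (b::'a::comm_ring_1) ^ n"
proof (induction n)
  case (Suc n)
  have "coeff ([:a, b:] * [:a, b:] ^ n) (1 + n) = b * coeff ([:a, b:] ^ n) n"
    by (subst coeff_mult_degree_le) (auto simp: degree_linear_power_le)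
  then show ?case using Suc by simp
qed auto

lemma coeff_prod_degree_le:
  fixes f :: "'i \<Rightarrow> 'a::comm_ring_1 poly"
  assumes "finite A" "\<And>i. i \<in> A \<Longrightarrow> degree (f i) \<le> b i"
  shows "coeff (\<Prod>i\<in>A. f i) (\<Sum>i\<in>A. b i) = (\<Prod>i\<in>A. coeff (f i) (b i))"
  using assms
proof (induction A rule: finite_induct)
  case (insert x A)
  then show ?case
    by (simp add: coeff_mult_degree_le degree_prod_le_sum)
qed auto

text \<open>
  The univariate polynomial \<open>t \<mapsto> f (w + t v)\<close> for the form \<open>f\<close> with coefficients \<open>c\<close>.
\<close>

definition line_form :: "nat \<Rightarrow> (('n::finite \<Rightarrow> nat) \<Rightarrow> real) \<Rightarrow> ('n \<Rightarrow> 'a) \<Rightarrow> ('n \<Rightarrow> 'a) \<Rightarrow> 'a::{real_algebra_1,comm_ring_1} poly" where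
  "line_form d c w v = form (\<lambda>r. [:of_real r:]) d c (\<lambda>i. [:w i, v i:])"

lemma poly_line_form: "poly (line_form d c w v) t = form of_real d c (\<lambda>i. w i + t * v i)"
  by (simp add: line_form_def poly_form)

lemma degree_line_form_le: "degree (line_form d c w v) \<le> d"
  unfolding line_form_def form_def
  by (intro degree_sum_le) (auto intro!: degree_prod_le_sum degree_linear_power_le order_trans[OF degree_smult_le] simp: finite_multi_indices)

lemma coeff_line_form_top: "coeff (line_form d c w v) d = form of_real d c v"
proof -
  have "coeff (\<Prod>i\<in>UNIV. [:w i, v i:] ^ \<alpha> i) d = (\<Prod>i\<in>UNIV. v i ^ \<alpha> i)" if "(\<Sum>i\<in>UNIV. \<alpha> i) = d" for \<alpha>
    using coeff_prod_degree_le[of UNIV "\<lambda>i. [:w i, v i:] ^ \<alpha> i" \<alpha>]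
    by (simp add: coeff_linear_power_top degree_linear_power_le that)
  then show ?thesis
    by (simp add: line_form_def form_def coeff_sum)
qed

text \<open>
  The univariate polynomial \<open>t \<mapsto> (D\<^sub>u f) (w + t v)\<close>.
\<close>

definition line_dform :: "nat \<Rightarrow> (('n::finite \<Rightarrow> nat) \<Rightarrow> real) \<Rightarrow> ('n \<Rightarrow> 'a) \<Rightarrow> ('n \<Rightarrow> 'a) \<Rightarrow> ('n \<Rightarrow> 'a) \<Rightarrow> 'a::{real_algebra_1,comm_ring_1} poly" where
  "line_dform d c w v u = dform (\<lambda>r. [:of_real r:]) d c (\<lambda>i. [:w i, v i:]) (\<lambda>i. [:u i:])"

lemma poly_line_dform:
  "poly (line_dform d c w v u) t = dform of_real d c (\<lambda>i. w i + t * v i) u"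
  by (simp add: line_dform_def poly_dform)

lemma degree_line_dform_le:
  fixes w v u :: "'n::finite \<Rightarrow> 'a::{real_algebra_1,comm_ring_1}"
  shows "degree (line_dform d c w v u) \<le> d - 1"
proof -
  have *: "degree (of_nat (\<alpha> i) * [:u i:] * [:w i, v i:] ^ (\<alpha> i - 1) * (\<Prod>j\<in>UNIV - {i}. [:w j, v j:] ^ \<alpha> j)) \<le> d - 1"
    if "(\<Sum>i\<in>UNIV. \<alpha> i) = d" for \<alpha> :: "'n \<Rightarrow> nat" and i
  proof (cases "\<alpha> i = 0")
    case False
    have "d = \<alpha> i + (\<Sum>j\<in>UNIV - {i}. \<alpha> j)"
      using that by (simp add: sum.remove[of UNIV i])
    moreover have "degree (of_nat (\<alpha> i) * [:u i:] * [:w i, v i:] ^ (\<alpha> i - 1) * (\<Prod>j\<in>UNIV - {i}. [:w j, v j:] ^ \<alpha> j))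
       \<le> (0 + 0 + (\<alpha> i - 1)) + (\<Sum>j\<in>UNIV - {i}. \<alpha> j)"
      by (intro order_trans[OF degree_mult_le] add_mono degree_linear_power_le degree_prod_le_sum) auto
    ultimately show ?thesis using False by simp
  qed simp
  have **: "degree ([:b:] * q) \<le> degree q" for b and q :: "'a poly"
    by (simp add: degree_smult_le)
  show ?thesis
    unfolding line_dform_def dform_def
  proof (rule degree_sum_le[OF finite_multi_indices], rule order_trans[OF **], rule degree_sum_le[OF finite])
    fix \<alpha> :: "'n \<Rightarrow> nat" and i
    assume "\<alpha> \<in> {\<alpha>. (\<Sum>i\<in>UNIV. \<alpha> i) = d}"
    then have "(\<Sum>i\<in>UNIV. \<alpha> i) = d" by simp
    then show "degree (of_nat (\<alpha> i) * [:u i:] * [:w i, v i:] ^ (\<alpha> i - 1) * (\<Prod>j\<in>UNIV - {i}. [:w j, v j:] ^ \<alpha> j)) \<le> d - 1"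
      by (rule *)
  qed
qed

lemma line_poly_eqI:
  assumes "\<And>t. poly q t = f (x + t *\<^sub>R e)"
  shows "line_poly f x e = q"
  unfolding line_poly_def
  by (rule the_equality) (use assms in \<open>auto simp: poly_eq_poly_eq_iff[symmetric] fun_eq_iff\<close>)

text \<open>
  Since a polynomial is determined by its values on the real numbers, complexifications are
  identified without computing with coefficients.
\<close>

lemma map_poly_of_real_eqI:
  fixes r :: "'a::{real_field,idom} poly"
  assumes "\<And>t. poly r (of_real t) = of_real (poly q t)"
  shows "map_poly of_real q = r"
proof (rule ccontr)
  assume ne: "map_poly of_real q \<noteq> r"
  have "poly (map_poly of_real q) (of_real t) = (of_real (poly q t) :: 'a)" for t
    by (induction q) (auto simp: map_poly_pCons)
  then have "range of_real \<subseteq> {z :: 'a. poly (map_poly of_real q - r) z = 0}"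
    using assms by auto
  moreover have "finite {z :: 'a. poly (map_poly of_real q - r) z = 0}"
    using ne by (intro poly_roots_finite) auto
  ultimately have "finite (range (of_real :: real \<Rightarrow> 'a))"
    by (rule finite_subset)
  then have "finite (UNIV :: real set)"
    by (rule finite_imageD) (rule injI, erule of_real_eq_iff[THEN iffD1])
  then show False by (rule notE[OF infinite_UNIV_char_0])
qed

section \<open>Zeros of complex polynomials\<close>

lemma complex_poly_induct [case_names const factor]:
  assumes "\<And>a. Q [:a:]" "\<And>s q. q \<noteq> 0 \<Longrightarrow> Q q \<Longrightarrow> Q ([:- s, 1:] * q)"
  shows "Q (q :: complex poly)"
proof (induction "degree q" arbitrary: q)
  case 0
  then show ?case using assms(1) by (metis degree_eq_zeroE)
next
  case (Suc n)
  then have "\<not> constant (poly q)" by (simp add: constant_degree)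
  then obtain s where "poly q s = 0" using fundamental_theorem_of_algebra by blast
  then obtain r where r: "q = [:- s, 1:] * r" by (auto simp: poly_eq_0_iff_dvd)
  with Suc have "r \<noteq> 0" by auto
  then have "degree q = Suc (degree r)" unfolding r by (subst degree_mult_eq) auto
  then show ?case
    using Suc assms(2) \<open>r \<noteq> 0\<close> unfolding r by simp
qed

text \<open>
  A quantitative form of the continuity of zeros: a point at which a polynomial is small must be
  close to a zero.
\<close>

lemma norm_poly_ge_of_roots_far:
  assumes "\<And>s. poly q s = 0 \<Longrightarrow> \<rho> \<le> norm (z - s)" "\<rho> \<ge> 0"
  shows "norm (lead_coeff q) * \<rho> ^ degree q \<le> norm (poly q (z :: complex))"
  using assms
proof (induction q rule: complex_poly_induct)
  case (factor s q)
  have "norm (lead_coeff ([:- s, 1:] * q)) * \<rho> ^ degree ([:- s, 1:] * q)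
      = \<rho> * (norm (lead_coeff q) * \<rho> ^ degree q)"
    by (subst lead_coeff_mult, subst degree_mult_eq) (use factor in auto)
  also have "\<dots> \<le> norm (z - s) * norm (poly q z)"
    using factor by (intro mult_mono) auto
  also have "\<dots> = norm (poly ([:- s, 1:] * q) z)"
    by (simp add: norm_mult[symmetric] algebra_simps)
  finally show ?case .
qed auto

text \<open>
  The logarithmic derivative at \<open>0\<close> is the sum of the \<open>- 1 / s\<close> over the zeros \<open>s\<close>.
\<close>

lemma Im_logderiv_nonpos:
  assumes "\<And>s. poly q s = 0 \<Longrightarrow> Im s < 0"
  shows "Im (poly (pderiv q) 0 / poly q 0) \<le> 0"
  using assms
proof (induction q rule: complex_poly_induct)
  case (factor s q)
  have "s \<noteq> 0" "poly q 0 \<noteq> 0" "Im s < 0" using factor(3)[of s] factor(3)[of 0] by auto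
  then have "poly (pderiv ([:- s, 1:] * q)) 0 / poly ([:- s, 1:] * q) 0
      = - inverse s + poly (pderiv q) 0 / poly q 0"
    unfolding pderiv_mult by (simp add: pderiv_pCons field_simps del: mult_pCons_left)
  moreover have "Im (- inverse s) \<le> 0"
    using \<open>Im s < 0\<close> by (simp add: divide_nonpos_nonneg)
  ultimately show ?case using factor by simp
qed (auto simp: pderiv_pCons)

section \<open>Partial fractions of real rational functions\<close>

text \<open>
  The complexification of a real polynomial.
\<close>

abbreviation cpoly :: "real poly \<Rightarrow> complex poly" where
  "cpoly \<equiv> map_poly of_real"

lemma poly_cpoly_of_real [simp]: "poly (cpoly q) (of_real t) = of_real (poly q t)"
  by (induction q) (auto simp: map_poly_pCons)

lemma cpoly_mult: "cpoly (p * q) = cpoly p * cpoly q"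
  by (rule map_poly_of_real_eqI) simp

lemma cpoly_linear: "cpoly [:a, b:] = [:of_real a, of_real b:]"
  by (simp add: map_poly_pCons)

lemma cpoly_power: "cpoly (p ^ n) = cpoly p ^ n"
  by (rule map_poly_of_real_eqI) simp

lemma real_rooted_dvd:
  fixes g h :: "real poly"
  assumes "g \<noteq> 0" "h \<noteq> 0" "\<And>z. poly (cpoly g) z = 0 \<Longrightarrow> z \<in> \<real>" "\<And>a. order a g \<le> order a h"
  shows "g dvd h"
  using assms
proof (induction "degree g" arbitrary: g h)
  case 0
  then obtain b where b: "g = [:b:]" using degree_eq_zeroE[of g] by auto
  with 0 have "h = g * Polynomial.smult (inverse b) h" by simp
  then show ?case by (rule dvdI)
next
  case (Suc n)
  have "degree (cpoly g) = Suc n" using Suc by (subst degree_map_poly) auto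
  then have "\<not> constant (poly (cpoly g))" by (simp add: constant_degree)
  then obtain z where "poly (cpoly g) z = 0" using fundamental_theorem_of_algebra by blast
  with Suc.prems(3) obtain a where "poly (cpoly g) (of_real a) = 0"
    by (metis Reals_cases)
  then have "poly g a = 0" by simp
  then obtain g' where g: "g = [:- a, 1:] * g'" by (auto simp: poly_eq_0_iff_dvd)
  have "order a g \<noteq> 0" using \<open>poly g a = 0\<close> Suc.prems by (simp add: order_root)
  then have "order a h \<noteq> 0" using Suc.prems(4)[of a] by simp
  then have "poly h a = 0" using Suc.prems by (simp add: order_root)
  then obtain h' where h: "h = [:- a, 1:] * h'" by (auto simp: poly_eq_0_iff_dvd)
  have nz: "g' \<noteq> 0" "h' \<noteq> 0" using g h Suc.prems by auto
  have "g' dvd h'"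
  proof (rule Suc.hyps(1))
    show "n = degree g'" using Suc.hyps(2) nz unfolding g by (subst (asm) degree_mult_eq) auto
    show "poly (cpoly g') z = 0 \<Longrightarrow> z \<in> \<real>" for z
      using Suc.prems(3)[of z] by (simp add: g cpoly_mult del: mult_pCons_left)
    show "order b g' \<le> order b h'" for b
    proof -
      have "order b g = order b [:- a, 1:] + order b g'" "order b h = order b [:- a, 1:] + order b h'"
        using Suc.prems(1,2) unfolding g h by (auto intro!: order_mult simp del: mult_pCons_left)
      then show ?thesis using Suc.prems(4)[of b] by simp
    qed
  qed (use nz in auto)
  then show ?case unfolding g h by (rule mult_dvd_mono[OF dvd_refl])
qed

text \<open>
  Near a pole of order at least \<open>2\<close> at a real point \<open>a\<close>, a real rational function takes values in both
  open half planes already on the upper half plane.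
\<close>

lemma order_le_Suc_order_of_Im_nonpos:
  fixes f g :: "real poly"
  assumes "f \<noteq> 0" "g \<noteq> 0"
    and Im: "\<And>z. Im z > 0 \<Longrightarrow> Im (poly (cpoly f) z / poly (cpoly g) z) \<le> 0"
  shows "order a g \<le> Suc (order a f)"
proof (rule ccontr)
  define r where "r = order a g - order a f"
  assume "\<not> ?thesis"
  then have r: "r \<ge> 2" "order a g = order a f + r" by (auto simp: r_def)
  obtain f1 where f1: "f = [:- a, 1:] ^ order a f * f1" "poly f1 a \<noteq> 0"
    using order_decomp[OF \<open>f \<noteq> 0\<close>] by (metis poly_eq_0_iff_dvd)
  obtain g1 where g1: "g = [:- a, 1:] ^ order a g * g1" "poly g1 a \<noteq> 0"
    using order_decomp[OF \<open>g \<noteq> 0\<close>] by (metis poly_eq_0_iff_dvd)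
  define A where "A = poly f1 a / poly g1 a"
  have "A \<noteq> 0" using f1 g1 by (simp add: A_def)
  \<comment> \<open>Up to a positive factor, \<open>f / g\<close> tends to \<open>A / \<omega> ^ r\<close> along the ray from \<open>a\<close> in the direction \<open>\<omega>\<close>.\<close>
  have *: "Im (inverse \<omega> ^ r) * A \<le> 0" if \<omega>: "Im \<omega> > 0" for \<omega>
  proof -
    define F where "F = (\<lambda>\<epsilon>. poly (cpoly f1) (of_real a + of_real \<epsilon> * \<omega>) / poly (cpoly g1) (of_real a + of_real \<epsilon> * \<omega>))"
    have "(F \<longlongrightarrow> F 0) (at_right 0)"
      unfolding F_def by (intro tendsto_intros) (use g1 in auto)
    moreover have "F 0 = of_real A" by (simp add: F_def A_def)
    ultimately have "((\<lambda>\<epsilon>. Im (inverse \<omega> ^ r * F \<epsilon>)) \<longlongrightarrow> Im (inverse \<omega> ^ r * of_real A)) (at_right 0)"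
      by (intro tendsto_intros) auto
    moreover have "\<forall>\<^sub>F \<epsilon> in at_right 0. Im (inverse \<omega> ^ r * F \<epsilon>) \<le> 0"
      unfolding eventually_at_right_field
    proof (intro exI[of _ 1] conjI allI impI)
      fix \<epsilon> :: real assume \<epsilon>: "0 < \<epsilon>" "\<epsilon> < 1"
      let ?z = "of_real a + of_real \<epsilon> * \<omega>"
      have "poly (cpoly f) ?z / poly (cpoly g) ?z
          = (of_real \<epsilon> * \<omega>) ^ order a f * poly (cpoly f1) ?z / ((of_real \<epsilon> * \<omega>) ^ order a g * poly (cpoly g1) ?z)"
        by (subst f1(1), subst g1(1)) (simp add: cpoly_mult cpoly_power cpoly_linear del: mult_pCons_left)
      also have "\<dots> = inverse (of_real \<epsilon> ^ r) * (inverse \<omega> ^ r * F \<epsilon>)"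
        using \<epsilon> \<omega> by (cases "\<omega> = 0") (auto simp: r F_def power_add power_mult_distrib divide_simps)
      also have "\<dots> = of_real (inverse (\<epsilon> ^ r)) * (inverse \<omega> ^ r * F \<epsilon>)" by simp
      finally have "Im (of_real (inverse (\<epsilon> ^ r)) * (inverse \<omega> ^ r * F \<epsilon>)) \<le> 0"
        using Im[of ?z] \<epsilon> \<omega> by simp
      then show "Im (inverse \<omega> ^ r * F \<epsilon>) \<le> 0"
        using \<epsilon> zero_less_power[OF \<epsilon>(1), of r] by (simp add: mult_le_0_iff del: of_real_inverse of_real_power)
    qed simp
    ultimately have "Im (inverse \<omega> ^ r * of_real A) \<le> 0"
      by (rule tendsto_upperbound) simp
    then show ?thesis by simp
  qed
  have cis: "Im (inverse (cis \<theta>) ^ r) = - sin (real r * \<theta>)" for \<theta>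
    unfolding cis_inverse Complex.DeMoivre by simp
  have pos: "Im (cis (k * pi / real r)) > 0" if "0 < k" "k < 2" for k
  proof -
    have "k * pi / real r < pi"
      using that r pi_gt_zero by (simp add: field_simps)
    moreover have "0 < k * pi / real r" using that r by simp
    ultimately show ?thesis by (simp add: sin_gt_zero)
  qed
  \<comment> \<open>The directions with arguments \<open>\<pi> / (2 r)\<close> and \<open>3 \<pi> / (2 r)\<close> give opposite signs; the second one lies
  in the upper half plane because \<open>r \<ge> 2\<close>.\<close>
  have "A \<ge> 0"
    using *[OF pos[of "1/2"]] r unfolding cis by simp
  moreover have "sin (3 / 2 * pi) = -1"
    using sin_3over2_pi by simp
  then have "A \<le> 0"
    using *[OF pos[of "3/2"]] r unfolding cis by simp
  ultimately show False using \<open>A \<noteq> 0\<close> by simp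
qed

text \<open>
  The unnormalised Lagrange basis: the product of the \<open>X - b\<close> over the nodes \<open>b \<noteq> a\<close>.
\<close>

definition lagrange_basis :: "'a::field set \<Rightarrow> 'a \<Rightarrow> 'a poly" where
  "lagrange_basis Z a = (\<Prod>b\<in>Z - {a}. [:- b, 1:])"

lemma poly_lagrange_basis: "finite Z \<Longrightarrow> a \<in> Z \<Longrightarrow> b \<in> Z \<Longrightarrow> poly (lagrange_basis Z a) b = 0 \<longleftrightarrow> a \<noteq> b"
  by (auto simp: lagrange_basis_def poly_prod)

lemma degree_lagrange_basis: "finite Z \<Longrightarrow> a \<in> Z \<Longrightarrow> degree (lagrange_basis Z a) < card Z"
  unfolding lagrange_basis_def by (subst degree_prod_eq_sum_degree) (auto simp: card_gt_0_iff intro!: diff_less)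

lemma poly_lagrange_sum:
  assumes "finite Z" "b \<in> Z"
  shows "poly (\<Sum>a\<in>Z. Polynomial.smult (k a) (lagrange_basis Z a)) b = k b * poly (lagrange_basis Z b) b"
proof -
  have "(\<Sum>a\<in>Z. k a * poly (lagrange_basis Z a) b) = (\<Sum>a\<in>{b}. k a * poly (lagrange_basis Z a) b)"
    using assms by (intro sum.mono_neutral_right) (auto simp: poly_lagrange_basis)
  then show ?thesis by (simp add: poly_sum)
qed

lemma degree_lagrange_sum:
  assumes "finite Z" "Z \<noteq> {}"
  shows "degree (\<Sum>a\<in>Z. Polynomial.smult (k a) (lagrange_basis Z a)) < card Z"
proof -
  have "degree (\<Sum>a\<in>Z. Polynomial.smult (k a) (lagrange_basis Z a)) \<le> card Z - 1"
    using assms degree_lagrange_basis[of Z]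
    by (intro degree_sum_le order_trans[OF degree_smult_le]) fastforce+
  moreover have "card Z > 0" using assms by (simp add: card_gt_0_iff)
  ultimately show ?thesis by linarith
qed

lemma lagrange_expansion:
  assumes "finite Z" "degree q < card Z"
  shows "q = (\<Sum>a\<in>Z. Polynomial.smult (poly q a / poly (lagrange_basis Z a) a) (lagrange_basis Z a))"
  using assms
  by (intro poly_eqI_degree[of Z] degree_lagrange_sum) (auto simp: poly_lagrange_sum poly_lagrange_basis)

lemma interpolating_poly:
  fixes v :: "real \<Rightarrow> real"
  assumes "finite Z"
  obtains q where "\<And>a. a \<in> Z \<Longrightarrow> poly q a = v a" "\<And>k. card Z \<le> k \<Longrightarrow> coeff q k = 0"
proof
  let ?q = "\<Sum>a\<in>Z. Polynomial.smult (v a / poly (lagrange_basis Z a) a) (lagrange_basis Z a)"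
  show "poly ?q a = v a" if "a \<in> Z" for a
    using that assms poly_lagrange_basis[of Z a a] by (simp add: poly_lagrange_sum)
  show "coeff ?q k = 0" if "card Z \<le> k" for k
  proof (cases "Z = {}")
    case False
    show ?thesis
      by (rule coeff_eq_0, rule less_le_trans[OF degree_lagrange_sum]) (use False assms that in auto)
  qed simp
qed

text \<open>
  A real rational function \<open>f / g\<close> that vanishes at infinity, has only real poles and maps the upper half
  plane into the closed lower half plane is \<open>(\<Sum>a\<in>Z. c a / (X - a))\<close> with all \<open>c a \<ge> 0\<close>.  The conclusion
  is stated without denominators.
\<close>

lemma partial_fractions_of_Im_nonpos:
  fixes f g :: "real poly"
  assumes "g \<noteq> 0" and real: "\<And>z. poly (cpoly g) z = 0 \<Longrightarrow> z \<in> \<real>"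
    and deg: "f = 0 \<or> degree f < degree g"
    and Im: "\<And>z. Im z > 0 \<Longrightarrow> Im (poly (cpoly f) z / poly (cpoly g) z) \<le> 0"
  defines "Z \<equiv> {a. poly g a = 0}"
  obtains c where "\<And>a. a \<in> Z \<Longrightarrow> c a \<ge> 0"
    "f * (\<Prod>a\<in>Z. [:- a, 1:]) = g * (\<Sum>a\<in>Z. Polynomial.smult (c a) (lagrange_basis Z a))"
proof (cases "f = 0")
  case True
  then show thesis by (intro that[of "\<lambda>_. 0"]) auto
next
  case False
  have fin: "finite Z" unfolding Z_def by (rule poly_roots_finite) fact
  define g0 where "g0 = (\<Prod>a\<in>Z. [:- a, 1:])"
  have g0_split: "g0 = [:- a, 1:] * lagrange_basis Z a" if "a \<in> Z" for a
    unfolding g0_def lagrange_basis_def by (rule prod.remove) (use fin that in auto)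
  have "g0 \<noteq> 0" using fin by (auto simp: g0_def)
  \<comment> \<open>All poles are simple.\<close>
  have "g dvd f * g0"
  proof (rule real_rooted_dvd)
    fix a
    show "order a g \<le> order a (f * g0)"
    proof (cases "a \<in> Z")
      case True
      have "order a g0 \<noteq> 0" using \<open>g0 \<noteq> 0\<close> True g0_split[OF True]
        by (metis order_root dvd_triv_left poly_eq_0_iff_dvd)
      then show ?thesis
        using order_le_Suc_order_of_Im_nonpos[OF False \<open>g \<noteq> 0\<close> Im, of a] False \<open>g0 \<noteq> 0\<close>
        by (subst order_mult) auto
    next
      case False
      then show ?thesis by (simp add: Z_def order_0I)
    qed
  qed (use assms False \<open>g0 \<noteq> 0\<close> in auto)
  then obtain N where N: "f * g0 = g * N" by blast
  have "N \<noteq> 0" using N False \<open>g0 \<noteq> 0\<close> by auto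
  have "degree g0 = card Z" unfolding g0_def by (subst degree_prod_eq_sum_degree) auto
  then have "degree f + card Z = degree g + degree N"
    using degree_mult_eq[OF False \<open>g0 \<noteq> 0\<close>] degree_mult_eq[OF \<open>g \<noteq> 0\<close> \<open>N \<noteq> 0\<close>] N by simp
  then have degN: "degree N < card Z" using deg False by auto
  show thesis
  proof (rule that)
    show "f * (\<Prod>a\<in>Z. [:- a, 1:]) = g * (\<Sum>a\<in>Z. Polynomial.smult (poly N a / poly (lagrange_basis Z a) a) (lagrange_basis Z a))"
      using N lagrange_expansion[OF fin degN] by (simp add: g0_def)
    fix a assume a: "a \<in> Z"
    let ?L = "lagrange_basis Z a"
    define F where "F = (\<lambda>\<epsilon>. poly (cpoly N) (of_real a + of_real \<epsilon> * \<i>) / poly (cpoly ?L) (of_real a + of_real \<epsilon> * \<i>))"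
    \<comment> \<open>The residue at \<open>a\<close> is the limit of \<open>(z - a) f(z) / g(z)\<close> as \<open>z\<close> approaches \<open>a\<close> vertically.\<close>
    have "(F \<longlongrightarrow> F 0) (at_right 0)"
      unfolding F_def by (intro tendsto_intros) (use a fin poly_lagrange_basis[of Z a a] in auto)
    then have "((\<lambda>\<epsilon>. Re (F \<epsilon>)) \<longlongrightarrow> Re (F 0)) (at_right 0)"
      by (intro tendsto_intros)
    moreover have "\<forall>\<^sub>F \<epsilon> in at_right 0. Re (F \<epsilon>) \<ge> 0"
      unfolding eventually_at_right_field
    proof (intro exI[of _ 1] conjI allI impI)
      fix \<epsilon> :: real assume \<epsilon>: "0 < \<epsilon>" "\<epsilon> < 1"
      let ?z = "of_real a + of_real \<epsilon> * \<i>"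
      have "poly (cpoly g) ?z \<noteq> 0"
        using real[of ?z] \<epsilon> by (auto simp: complex_is_Real_iff)
      moreover have "poly (cpoly f) ?z * (of_real \<epsilon> * \<i> * poly (cpoly ?L) ?z) = poly (cpoly g) ?z * poly (cpoly N) ?z"
        using arg_cong[OF N[unfolded g0_split[OF a]], of "\<lambda>q. poly (cpoly q) ?z"]
        by (simp add: cpoly_mult cpoly_linear del: mult_pCons_left)
      moreover have "poly (cpoly ?L) ?z \<noteq> 0"
      proof
        assume *: "poly (cpoly ?L) ?z = 0"
        have "cpoly g0 = (\<Prod>a\<in>Z. [:- of_real a, 1:])"
          by (rule map_poly_of_real_eqI) (simp add: g0_def poly_prod)
        moreover have "poly (cpoly g0) ?z = 0"
          unfolding g0_split[OF a] cpoly_mult using * by simp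
        ultimately obtain b where "?z = of_real b"
          using fin by (auto simp: poly_prod)
        then show False using \<epsilon> by (simp add: complex_eq_iff)
      qed
      ultimately have "poly (cpoly f) ?z / poly (cpoly g) ?z = F \<epsilon> / (of_real \<epsilon> * \<i>)"
        using \<epsilon> by (simp add: F_def field_simps)
      then have "Im (F \<epsilon> / (of_real \<epsilon> * \<i>)) \<le> 0"
        using Im[of ?z] \<epsilon> by simp
      moreover have "Im (F \<epsilon> / (of_real \<epsilon> * \<i>)) = - Re (F \<epsilon>) / \<epsilon>"
        using \<epsilon> by (simp add: Im_divide power2_eq_square)
      ultimately show "Re (F \<epsilon>) \<ge> 0"
        using \<epsilon> by (simp add: zero_le_divide_iff)
    qed simp
    ultimately have "Re (F 0) \<ge> 0"
      by (rule tendsto_lowerbound) simp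
    then show "poly N a / poly ?L a \<ge> 0"
      by (simp add: F_def flip: of_real_divide)
  qed
qed

section \<open>Expansions at infinity and Hankel forms\<close>

text \<open>
  A polynomial as a Laurent series in \<open>t\<inverse>\<close>.
\<close>

definition at_inf :: "real poly \<Rightarrow> real fls" where
  "at_inf q = poly (map_poly fls_const q) fls_X_inv"

lemma at_inf_pCons [simp]: "at_inf (pCons a q) = fls_const a + fls_X_inv * at_inf q"
  by (simp add: at_inf_def map_poly_pCons)

lemma at_inf_0 [simp]: "at_inf 0 = 0"
  by (simp add: at_inf_def)

lemma at_inf_add: "at_inf (p + q) = at_inf p + at_inf q"
  by (induction p q rule: poly_induct2) (auto simp: fls_plus_const algebra_simps)

lemma at_inf_smult: "at_inf (Polynomial.smult k q) = fls_const k * at_inf q"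
  by (induction q) (auto simp: algebra_simps)

lemma at_inf_mult: "at_inf (p * q) = at_inf p * at_inf q"
  by (induction p) (auto simp: at_inf_add at_inf_smult algebra_simps)

lemma at_inf_sum: "at_inf (\<Sum>a\<in>A. f a) = (\<Sum>a\<in>A. at_inf (f a))"
  by (induction A rule: infinite_finite_induct) (auto simp: at_inf_add)

lemma fls_nth_at_inf: "fls_nth (at_inf q) n = (if n \<le> 0 then coeff q (nat (- n)) else 0)"
proof (induction q arbitrary: n)
  case (pCons a q)
  then show ?case
    by (cases "n = 0")
       (auto simp: fls_X_inv_times_conv_shift coeff_pCons nat_diff_distrib split: nat.splits
             intro!: arg_cong[where f = "coeff q"])
qed simp

lemma at_inf_eq_0_iff [simp]: "at_inf q = 0 \<longleftrightarrow> q = 0"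
proof
  assume *: "at_inf q = 0"
  show "q = 0"
  proof (rule poly_eqI)
    fix n show "coeff q n = coeff 0 n"
      using fls_nth_at_inf[of q "- int n"] * by simp
  qed
qed simp

text \<open>
  The expansion \<open>(\<Sum>k. a\<^bsup>k\<^esup> t\<^bsup>-k-1\<^esup>)\<close> of \<open>1 / (t - a)\<close> at infinity.
\<close>

definition geometric_fls :: "real \<Rightarrow> real fls" where
  "geometric_fls a = fps_to_fls (Abs_fps (\<lambda>n. if n = 0 then 0 else a ^ (n - 1)))"

lemma geometric_fls_nth [simp]: "fls_nth (geometric_fls a) (int (Suc k)) = a ^ k"
  by (simp add: geometric_fls_def nat_add_distrib)

lemma at_inf_linear_times_geometric: "at_inf [:- a, 1:] * geometric_fls a = 1"
proof (rule fls_eqI)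
  fix n :: int
  consider "n < 0" | "n = 0" | m where "n = int (Suc m)"
  proof (cases "n > 0")
    case True
    then show thesis by (intro that(3)[of "nat n - 1"]) auto
  qed (use that in force)
  then show "fls_nth (at_inf [:- a, 1:] * geometric_fls a) n = fls_nth 1 n"
    by cases (auto simp: ring_distribs fls_X_inv_times_conv_shift geometric_fls_def nat_add_distrib)
qed

lemma expansion_at_infinity_partial_fractions:
  assumes "finite Z" "g \<noteq> 0"
    and eq: "f * (\<Prod>a\<in>Z. [:- a, 1:]) = g * (\<Sum>a\<in>Z. Polynomial.smult (c a) (lagrange_basis Z a))"
  shows "expansion_at_infinity f g = (\<Sum>a\<in>Z. fls_const (c a) * geometric_fls a)"
proof -
  let ?g0 = "at_inf (\<Prod>a\<in>Z. [:- a, 1:])"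
  have split: "at_inf (lagrange_basis Z a) = ?g0 * geometric_fls a" if "a \<in> Z" for a
  proof -
    have "?g0 = at_inf [:- a, 1:] * at_inf (lagrange_basis Z a)"
      unfolding at_inf_mult[symmetric] lagrange_basis_def
      by (subst prod.remove[OF assms(1) that]) (rule refl)
    then have "?g0 * geometric_fls a = (at_inf [:- a, 1:] * geometric_fls a) * at_inf (lagrange_basis Z a)"
      by (simp only: ac_simps)
    then show ?thesis by (simp only: at_inf_linear_times_geometric mult_1_left)
  qed
  have "at_inf f * ?g0 = at_inf g * (\<Sum>a\<in>Z. fls_const (c a) * at_inf (lagrange_basis Z a))"
    unfolding at_inf_mult[symmetric] eq by (simp add: at_inf_mult at_inf_sum at_inf_smult)
  also have "\<dots> = at_inf g * (\<Sum>a\<in>Z. fls_const (c a) * geometric_fls a) * ?g0"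
    by (simp add: split sum_distrib_left sum_distrib_right ac_simps)
  finally have "at_inf f = at_inf g * (\<Sum>a\<in>Z. fls_const (c a) * geometric_fls a)"
    using assms(1) by simp
  then show ?thesis
    using \<open>g \<noteq> 0\<close> by (simp add: expansion_at_infinity_def at_inf_def[symmetric])
qed

lemma eval_partial_fractions:
  assumes "finite Z" "poly g t \<noteq> 0" "t \<notin> Z"
    and eq: "f * (\<Prod>a\<in>Z. [:- a, 1:]) = g * (\<Sum>a\<in>Z. Polynomial.smult (c a) (lagrange_basis Z a))"
  shows "poly f t / poly g t = (\<Sum>a\<in>Z. c a / (t - a))"
proof -
  define q where "q = poly (\<Prod>a\<in>Z. [:- a, 1:]) t"
  have "q \<noteq> 0" using assms by (auto simp: q_def poly_prod)
  have split: "poly (lagrange_basis Z a) t = q / (t - a)" if "a \<in> Z" for a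
  proof -
    have "q = (t - a) * poly (lagrange_basis Z a) t"
      unfolding q_def lagrange_basis_def by (subst prod.remove[OF assms(1) that]) (simp add: left_diff_distrib)
    moreover have "t \<noteq> a" using that assms by auto
    ultimately show ?thesis by simp
  qed
  have "poly f t * q = poly g t * (\<Sum>a\<in>Z. c a * poly (lagrange_basis Z a) t)"
    using arg_cong[OF eq, of "\<lambda>r. poly r t"] by (simp add: q_def poly_sum)
  also have "\<dots> = poly g t * (\<Sum>a\<in>Z. c a / (t - a)) * q"
    by (simp add: split sum_distrib_left sum_distrib_right ac_simps)
  finally show ?thesis
    using \<open>q \<noteq> 0\<close> assms(2) by simp
qed

lemma hankel_form_eq_sum:
  fixes h :: "nat \<Rightarrow> real"
  assumes "y \<in> carrier_vec d"
  shows "scalar_prod y (mat d d (\<lambda>(i, j). h (i + j + 1)) *\<^sub>v y)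
     = (\<Sum>i<d. \<Sum>j<d. vec_index y i * (h (Suc (i + j)) * vec_index y j))"
  using assms by (simp add: scalar_prod_def sum_distrib_left atLeast0LessThan)

lemma hankel_form_eq_sum_squares:
  fixes h :: "nat \<Rightarrow> real"
  assumes y: "y \<in> carrier_vec d" and h: "\<And>k. h (Suc k) = (\<Sum>a\<in>Z. c a * a ^ k)"
  shows "scalar_prod y (mat d d (\<lambda>(i, j). h (i + j + 1)) *\<^sub>v y)
     = (\<Sum>a\<in>Z. c a * (\<Sum>i<d. vec_index y i * a ^ i)\<^sup>2)"
proof -
  have "scalar_prod y (mat d d (\<lambda>(i, j). h (i + j + 1)) *\<^sub>v y)
      = (\<Sum>i<d. \<Sum>j<d. vec_index y i * (h (Suc (i + j)) * vec_index y j))"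
    by (rule hankel_form_eq_sum[OF y])
  also have "\<dots> = (\<Sum>i<d. \<Sum>j<d. \<Sum>a\<in>Z. c a * ((vec_index y i * a ^ i) * (vec_index y j * a ^ j)))"
    by (simp add: h sum_distrib_left sum_distrib_right power_add ac_simps)
  also have "\<dots> = (\<Sum>i<d. \<Sum>a\<in>Z. \<Sum>j<d. c a * ((vec_index y i * a ^ i) * (vec_index y j * a ^ j)))"
    by (intro sum.cong refl sum.swap)
  also have "\<dots> = (\<Sum>a\<in>Z. \<Sum>i<d. \<Sum>j<d. c a * ((vec_index y i * a ^ i) * (vec_index y j * a ^ j)))"
    by (rule sum.swap)
  also have "\<dots> = (\<Sum>a\<in>Z. c a * (\<Sum>i<d. vec_index y i * a ^ i)\<^sup>2)"
    unfolding power2_eq_square sum_product by (simp add: sum_distrib_left)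
  finally show ?thesis .
qed

section \<open>Relative interiors of dual cones\<close>

text \<open>
  Otherwise \<open>\<xi> + s (\<xi> - \<eta>)\<close>, which is in the dual cone for small \<open>s > 0\<close>, would be negative at \<open>x\<close>.
\<close>

lemma rel_interior_dual_cone_vanish:
  assumes \<xi>: "\<xi> \<in> rel_interior (dual_cone K)" and "x \<in> K" and 0: "blinfun_apply \<xi> x = 0"
    and \<eta>: "\<eta> \<in> dual_cone K"
  shows "blinfun_apply \<eta> x = 0"
proof (rule antisym)
  show "0 \<le> blinfun_apply \<eta> x" using \<eta> \<open>x \<in> K\<close> by (simp add: dual_cone_def)
  obtain \<epsilon> where \<epsilon>: "\<epsilon> > 0" "ball \<xi> \<epsilon> \<inter> affine hull dual_cone K \<subseteq> dual_cone K" and "\<xi> \<in> dual_cone K"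
    using \<xi> unfolding mem_rel_interior_ball by blast
  define s where "s = \<epsilon> / (2 * (norm (\<xi> - \<eta>) + 1))"
  have n: "norm (\<xi> - \<eta>) + 1 > 0" by (rule add_nonneg_pos) auto
  have "s > 0" using \<epsilon> n by (simp add: s_def)
  define \<zeta> where "\<zeta> = (1 + s) *\<^sub>R \<xi> + (- s) *\<^sub>R \<eta>"
  have "\<zeta> \<in> affine hull dual_cone K"
    unfolding \<zeta>_def by (rule mem_affine) (use \<eta> \<open>\<xi> \<in> dual_cone K\<close> in \<open>auto intro: hull_inc\<close>)
  moreover have "dist \<xi> \<zeta> < \<epsilon>"
  proof -
    have "dist \<xi> \<zeta> = norm (- (s *\<^sub>R (\<xi> - \<eta>)))"
      by (simp add: dist_norm \<zeta>_def algebra_simps)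
    also have "\<dots> = s * norm (\<xi> - \<eta>)" using \<open>s > 0\<close> by simp
    also have "\<dots> < s * (norm (\<xi> - \<eta>) + 1)" using \<open>s > 0\<close> by simp
    also have "\<dots> = \<epsilon> / 2" unfolding s_def using n by (simp add: divide_simps)
    also have "\<dots> < \<epsilon>" using \<epsilon> by simp
    finally show ?thesis .
  qed
  ultimately have "\<zeta> \<in> dual_cone K" using \<epsilon> by auto
  then have "0 \<le> blinfun_apply \<zeta> x" using \<open>x \<in> K\<close> by (simp add: dual_cone_def)
  then have "s * blinfun_apply \<eta> x \<le> 0"
    by (simp add: \<zeta>_def 0 blinfun.diff_left blinfun.scaleR_left)
  then show "blinfun_apply \<eta> x \<le> 0" using \<open>s > 0\<close> by (simp add: mult_le_0_iff)
qed

lemma closed_orthogonal_set: "closed {x. \<forall>w\<in>A. inner x w = 0}"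
proof -
  have "{x. \<forall>w\<in>A. inner x w = 0} = (\<Inter>w\<in>A. {x. inner x w = 0})" by auto
  then show ?thesis by (auto intro!: closed_INT closed_Collect_eq continuous_intros)
qed

section \<open>The hyperbolicity cone\<close>

lemma vec_nth_line: "vec_nth (x + t *\<^sub>R v) = (\<lambda>i. vec_nth x i + t * vec_nth v i)"
  by (rule ext) simp

lemma vec_nth_scaleR: "vec_nth (k *\<^sub>R x) = (\<lambda>i. k * vec_nth x i)"
  by (rule ext) simp

text \<open>
  A hyperbolic polynomial, together with a choice of coefficients.
\<close>

locale hyperbolic_form =
  fixes p :: "real ^ 'n \<Rightarrow> real" and d :: nat and e :: "real ^ 'n" and c :: "('n \<Rightarrow> nat) \<Rightarrow> real"
  assumes p_eq: "p x = form of_real d c (vec_nth x)"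
    and p_e_pos: "p e > 0"
    and line_real_rooted: "poly (cpoly (line_poly p x e)) z = 0 \<Longrightarrow> z \<in> \<real>"
begin

text \<open>
  The extension of \<open>p\<close> to complex arguments.
\<close>

definition pC :: "('n \<Rightarrow> complex) \<Rightarrow> complex" where
  "pC w = form of_real d c w"

lemma pC_of_real: "pC (\<lambda>i. of_real (vec_nth x i)) = of_real (p x)"
  by (simp add: pC_def p_eq form_of_real)

lemma line_poly_p: "line_poly p x v = line_form d c (vec_nth x) (vec_nth v)"
  by (rule line_poly_eqI) (simp add: poly_line_form p_eq vec_nth_line)

lemma cpoly_line_poly:
  "cpoly (line_poly p x v) = line_form d c (\<lambda>i. of_real (vec_nth x i)) (\<lambda>i. of_real (vec_nth v i))"
  by (rule map_poly_of_real_eqI)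
     (simp add: line_poly_p poly_line_form form_of_real[symmetric] del: of_real_eq_id)

lemma poly_cpoly_line_poly:
  "poly (cpoly (line_poly p x v)) z = pC (\<lambda>i. of_real (vec_nth x i) + z * of_real (vec_nth v i))"
  by (simp add: cpoly_line_poly poly_line_form pC_def)

lemma pC_eq_0_imp_real: "pC (\<lambda>i. of_real (vec_nth x i) + z * of_real (vec_nth e i)) = 0 \<Longrightarrow> z \<in> \<real>"
  using line_real_rooted by (simp add: poly_cpoly_line_poly)

lemma pC_scale: "pC (\<lambda>i. k * w i) = k ^ d * pC w"
  by (simp add: pC_def form_scale)

lemma p_scale: "p (k *\<^sub>R x) = k ^ d * p x"
  by (simp only: p_eq vec_nth_scaleR form_scale)

lemma continuous_on_p [continuous_intros]:
  "continuous_on S f \<Longrightarrow> continuous_on S (\<lambda>x. p (f x))"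
  unfolding p_eq by (intro continuous_intros)

lemma line_poly_degree: "p v \<noteq> 0 \<Longrightarrow> degree (line_poly p x v) = d"
  and line_poly_lead_coeff: "p v \<noteq> 0 \<Longrightarrow> lead_coeff (line_poly p x v) = p v"
proof -
  assume nz: "p v \<noteq> 0"
  have co: "coeff (line_poly p x v) d = p v"
    by (simp add: line_poly_p coeff_line_form_top p_eq)
  show deg: "degree (line_poly p x v) = d"
    by (rule antisym) (use nz co in \<open>auto intro: le_degree simp: line_poly_p degree_line_form_le\<close>)
  show "lead_coeff (line_poly p x v) = p v" using co deg by simp
qed

abbreviation "hcone \<equiv> hyperbolicity_cone p e"

text \<open>
  The open hyperbolicity cone: all zeros of \<open>t \<mapsto> p (x + t e)\<close> are negative.
\<close>

definition open_hcone :: "(real ^ 'n) set" where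
  "open_hcone = {x. \<forall>t\<ge>0. p (x + t *\<^sub>R e) \<noteq> 0}"

lemma mem_hcone_iff: "x \<in> hcone \<longleftrightarrow> (\<forall>t>0. p (x + t *\<^sub>R e) \<noteq> 0)"
proof -
  have "p (t *\<^sub>R e - x) = (- 1) ^ d * p (x + (- t) *\<^sub>R e)" for t
    using p_scale[of "- 1" "x + (- t) *\<^sub>R e"] by (simp add: algebra_simps)
  then have "x \<in> hcone \<longleftrightarrow> (\<forall>t. p (x + (- t) *\<^sub>R e) = 0 \<longrightarrow> t \<ge> 0)"
    by (simp add: hyperbolicity_cone_def)
  also have "\<dots> \<longleftrightarrow> (\<forall>t>0. p (x + t *\<^sub>R e) \<noteq> 0)"
    by (metis add.inverse_inverse neg_0_le_iff_le not_le)
  finally show ?thesis .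
qed

lemma open_hcone_subset: "open_hcone \<subseteq> hcone"
  by (auto simp: open_hcone_def mem_hcone_iff)

lemma hcone_add_e: "x \<in> hcone \<Longrightarrow> t > 0 \<Longrightarrow> x + t *\<^sub>R e \<in> open_hcone"
  by (auto simp: open_hcone_def mem_hcone_iff scaleR_add_left[symmetric] add.assoc)

lemma hcone_p_nonzero: "x \<in> hcone \<Longrightarrow> p x \<noteq> 0 \<Longrightarrow> x \<in> open_hcone"
  by (auto simp: open_hcone_def mem_hcone_iff le_less)

lemma p_line_scale: "k \<noteq> 0 \<Longrightarrow> p (k *\<^sub>R x + t *\<^sub>R e) = k ^ d * p (x + (t / k) *\<^sub>R e)"
  using p_scale[of k "x + (t / k) *\<^sub>R e"] by (simp add: algebra_simps)

lemma open_hcone_scale: "x \<in> open_hcone \<Longrightarrow> k > 0 \<Longrightarrow> k *\<^sub>R x \<in> open_hcone"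
  by (simp add: open_hcone_def p_line_scale)

lemma hcone_scale: "x \<in> hcone \<Longrightarrow> k > 0 \<Longrightarrow> k *\<^sub>R x \<in> hcone"
  by (simp add: mem_hcone_iff p_line_scale)

lemma e_in_open_hcone: "e \<in> open_hcone"
proof -
  have "p (e + t *\<^sub>R e) = (1 + t) ^ d * p e" for t
    using p_scale[of "1 + t" e] by (simp add: algebra_simps)
  then show ?thesis using p_e_pos by (auto simp: open_hcone_def)
qed

lemma open_open_hcone: "open open_hcone"
proof -
  \<comment> \<open>The zeros \<open>t \<ge> 0\<close> range over a compact set after the substitution \<open>r = 1 / t\<close> for \<open>t \<ge> 1\<close>.\<close>
  have "- open_hcone = {x. \<exists>t. t \<in> {0..1} \<and> (t, x) \<in> {(t, x). p (x + t *\<^sub>R e) = 0}}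
      \<union> {x. \<exists>r. r \<in> {0..1} \<and> (r, x) \<in> {(r, x). p (r *\<^sub>R x + e) = 0}}" (is "_ = ?A \<union> ?B")
  proof (intro equalityI subsetI)
    fix x assume "x \<in> - open_hcone"
    then obtain t where t: "t \<ge> 0" "p (x + t *\<^sub>R e) = 0" by (auto simp: open_hcone_def)
    show "x \<in> ?A \<union> ?B"
    proof (cases "t \<le> 1")
      case False
      then have "p ((1 / t) *\<^sub>R x + e) = 0"
        using p_line_scale[of "1 / t" x 1] t by simp
      then show ?thesis using False by (intro UnI2 CollectI exI[of _ "1 / t"]) auto
    qed (use t in auto)
  next
    fix x assume "x \<in> ?A \<union> ?B"
    then show "x \<in> - open_hcone"
    proof
      assume "x \<in> ?B"
      then obtain r where r: "r \<ge> 0" "p (r *\<^sub>R x + e) = 0" by auto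
      then have "r \<noteq> 0" using p_e_pos by auto
      then have "p (x + (1 / r) *\<^sub>R e) = 0"
        using p_line_scale[of r x 1] r by simp
      then show ?thesis using r by (force simp: open_hcone_def)
    qed (auto simp: open_hcone_def)
  qed
  moreover have "closed ?A" "closed ?B"
    by (intro closed_compact_projection; simp add: case_prod_unfold;
        intro closed_Collect_eq continuous_intros)+
  ultimately have "closed (- open_hcone)" by (simp only: closed_Un)
  then show ?thesis by (simp add: closed_def)
qed

lemma eventually_in_open_hcone: "\<forall>\<^sub>F t in at_top. x + t *\<^sub>R e \<in> open_hcone"
proof -
  have "((\<lambda>r. e + r *\<^sub>R x) \<longlongrightarrow> e + 0 *\<^sub>R x) (at_right 0)"
    by (intro tendsto_intros)
  then have "\<forall>\<^sub>F r in at_right 0. e + r *\<^sub>R x \<in> open_hcone"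
    by (rule topological_tendstoD) (auto simp: open_open_hcone e_in_open_hcone)
  then have "\<forall>\<^sub>F t in at_top. e + inverse t *\<^sub>R x \<in> open_hcone"
    by (simp add: at_right_to_top eventually_filtermap)
  then show ?thesis
    using eventually_gt_at_top[of 0]
  proof eventually_elim
    case (elim t)
    have "t *\<^sub>R (e + inverse t *\<^sub>R x) \<in> open_hcone" using elim by (intro open_hcone_scale)
    then show ?case using elim by (simp add: algebra_simps)
  qed
qed

lemma p_pos_on_open_hcone: "x \<in> open_hcone \<Longrightarrow> p x > 0"
proof (rule ccontr)
  assume x: "x \<in> open_hcone" and "\<not> p x > 0"
  then have neg: "p x \<le> 0" by simp
  have "((\<lambda>r. p (e + r *\<^sub>R x)) \<longlongrightarrow> p (e + 0 *\<^sub>R x)) (at_right 0)"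
  proof -
    have "continuous_on UNIV (\<lambda>r. p (e + r *\<^sub>R x))" by (intro continuous_intros)
    then have "isCont (\<lambda>r. p (e + r *\<^sub>R x)) 0" by (simp add: continuous_on_eq_continuous_at)
    then show ?thesis by (simp add: isCont_def filterlim_at_split)
  qed
  then have "\<forall>\<^sub>F r in at_right 0. p (e + r *\<^sub>R x) > 0"
    using p_e_pos by (intro order_tendstoD(1)) auto
  then have "\<exists>r>0. p (e + r *\<^sub>R x) > 0"
    unfolding eventually_at_right_field by (metis field_lbound_gt_zero dense)
  then obtain r where r: "r > 0" "p (e + r *\<^sub>R x) > 0" by blast
  then have pos: "p (x + (1 / r) *\<^sub>R e) > 0"
    using p_line_scale[of r x 1] by (simp add: add.commute zero_less_mult_iff)
  have "\<exists>t. 0 \<le> t \<and> t \<le> 1 / r \<and> p (x + t *\<^sub>R e) = 0"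
    by (rule IVT') (use neg pos r in \<open>auto intro!: continuous_intros\<close>)
  then show False using x by (auto simp: open_hcone_def)
qed

text \<open>
  For \<open>x\<close> in the cone all zeros of \<open>t \<mapsto> p (x + t e)\<close> are at most \<open>0\<close>, and so have distance at least \<open>s\<close> from
  \<open>s > 0\<close>.  The resulting description of the cone is by closed conditions.
\<close>

lemma hcone_eq: "hcone = {x. \<forall>s\<in>{0<..}. p e * s ^ d \<le> p (x + s *\<^sub>R e)}"
proof (intro equalityI subsetI CollectI ballI)
  fix x s assume x: "x \<in> hcone" and "s \<in> {0 :: real<..}"
  then have s: "s > 0" by simp
  have "norm (lead_coeff (cpoly (line_poly p x e))) * s ^ degree (cpoly (line_poly p x e))
      \<le> norm (poly (cpoly (line_poly p x e)) (of_real s))"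
  proof (rule norm_poly_ge_of_roots_far)
    fix z assume z: "poly (cpoly (line_poly p x e)) z = 0"
    then obtain r where r: "z = of_real r" using line_real_rooted Reals_cases by blast
    then have "p (x + r *\<^sub>R e) = 0"
      using z by (simp add: line_poly_p poly_line_form p_eq vec_nth_line)
    then have "r \<le> 0" using x unfolding mem_hcone_iff by (meson not_le)
    then show "s \<le> norm (of_real s - z)"
      unfolding r of_real_diff[symmetric] norm_of_real by simp
  qed (use s in simp)
  then have "p e * s ^ d \<le> \<bar>p (x + s *\<^sub>R e)\<bar>"
    using p_e_pos line_poly_degree[of e x] line_poly_lead_coeff[of e x]
    by (simp add: degree_map_poly coeff_map_poly) (simp add: line_poly_p poly_line_form p_eq vec_nth_line)
  then show "p e * s ^ d \<le> p (x + s *\<^sub>R e)"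
    using p_pos_on_open_hcone[OF hcone_add_e[OF x s]] by simp
next
  fix x assume x: "x \<in> {x. \<forall>s\<in>{0<..}. p e * s ^ d \<le> p (x + s *\<^sub>R e)}"
  show "x \<in> hcone"
    unfolding mem_hcone_iff
  proof (intro allI impI)
    fix t :: real assume t: "t > 0"
    then have "p e * t ^ d \<le> p (x + t *\<^sub>R e)" using x by auto
    moreover have "0 < p e * t ^ d" using t p_e_pos by simp
    ultimately show "p (x + t *\<^sub>R e) \<noteq> 0" by linarith
  qed
qed

lemma closed_hcone: "closed hcone"
proof -
  have "hcone = (\<Inter>s\<in>{0<..}. {x. p e * s ^ d \<le> p (x + s *\<^sub>R e)})"
    unfolding hcone_eq by auto
  then show ?thesis
    by (auto intro!: closed_INT closed_Collect_le continuous_intros)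
qed

section \<open>Stability\<close>

lemma pC_nonzero_of_real_s:
  assumes "Im s = 0" "\<delta> \<noteq> 0"
  shows "pC (\<lambda>i. of_real (vec_nth y i) + \<i> * of_real \<delta> * of_real (vec_nth e i) + s * of_real (vec_nth u i)) \<noteq> 0"
proof
  assume *: "pC (\<lambda>i. of_real (vec_nth y i) + \<i> * of_real \<delta> * of_real (vec_nth e i) + s * of_real (vec_nth u i)) = 0"
  have "s = of_real (Re s)" using assms by (simp add: complex_eq_iff)
  then have "(\<lambda>i. of_real (vec_nth y i) + \<i> * of_real \<delta> * of_real (vec_nth e i) + s * of_real (vec_nth u i))
     = (\<lambda>i. of_real (vec_nth (y + Re s *\<^sub>R u) i) + (\<i> * of_real \<delta>) * of_real (vec_nth e i))"
    by (auto simp: fun_eq_iff)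
  with * have "\<i> * of_real \<delta> \<in> \<real>" by (metis pC_eq_0_imp_real)
  then show False using assms by (simp add: complex_is_Real_iff)
qed

text \<open>
  The starting point of the deformation: at the origin the zeros \<open>s\<close> are \<open>\<i> \<delta> / r\<close> with \<open>r < 0\<close> a zero of
  \<open>t \<mapsto> p (u + t e)\<close>.
\<close>

lemma pC_root_Im_neg_at_0:
  assumes u: "u \<in> open_hcone" and "\<delta> > 0"
    and root: "pC (\<lambda>i. \<i> * of_real \<delta> * of_real (vec_nth e i) + s * of_real (vec_nth u i)) = 0"
  shows "Im s < 0"
proof -
  have "s \<noteq> 0"
  proof
    assume "s = 0"
    then have "(\<i> * of_real \<delta>) ^ d * of_real (p e) = (0 :: complex)"
      using root pC_scale[of "\<i> * of_real \<delta>"] by (simp add: pC_of_real[symmetric])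
    then show False using \<open>\<delta> > 0\<close> p_e_pos by simp
  qed
  define t where "t = \<i> * of_real \<delta> / s"
  have "(\<lambda>i. \<i> * of_real \<delta> * of_real (vec_nth e i) + s * of_real (vec_nth u i))
      = (\<lambda>i. s * (of_real (vec_nth u i) + t * of_real (vec_nth e i)))"
    by (rule ext) (use \<open>s \<noteq> 0\<close> in \<open>simp add: t_def field_simps\<close>)
  then have "s ^ d * pC (\<lambda>i. of_real (vec_nth u i) + t * of_real (vec_nth e i)) = 0"
    using root by (simp add: pC_scale)
  then have 0: "pC (\<lambda>i. of_real (vec_nth u i) + t * of_real (vec_nth e i)) = 0"
    using \<open>s \<noteq> 0\<close> by simp
  then obtain r where r: "t = of_real r" using pC_eq_0_imp_real Reals_cases by blast
  have "pC (\<lambda>i. of_real (vec_nth (u + r *\<^sub>R e) i)) = 0"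
    using 0 by (simp add: r)
  then have "p (u + r *\<^sub>R e) = 0" by (simp only: pC_of_real of_real_eq_0_iff)
  then have "r < 0" using u unfolding open_hcone_def by (metis (mono_tags, lifting) mem_Collect_eq not_le)
  have "s * of_real r = \<i> * of_real \<delta>" using \<open>s \<noteq> 0\<close> by (simp add: t_def flip: r)
  then have "Im s * r = \<delta>" by (simp add: complex_eq_iff)
  then show ?thesis using \<open>r < 0\<close> \<open>\<delta> > 0\<close> mult_nonneg_nonpos[of "Im s" r] by (force simp: not_le[symmetric])
qed

text \<open>
  Stability.  The real part of \<open>t\<close> is absorbed into \<open>y\<close>, and \<open>\<tau> y\<close> is deformed from \<open>y\<close> to \<open>0\<close>.  The set
  \<open>A\<close> of those real \<open>\<tau>\<close> for which there is a zero \<open>s\<close> in the closed upper half plane is open, since no zero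
  is real and zeros depend continuously on \<open>\<tau>\<close>; it is closed, since zeros stay bounded; and it
  does not contain \<open>0\<close>.
\<close>

lemma pC_stable:
  assumes u: "u \<in> open_hcone" and t: "Im t > 0" and s: "Im s \<ge> 0"
  shows "pC (\<lambda>i. of_real (vec_nth x i) + t * of_real (vec_nth e i) + s * of_real (vec_nth u i)) \<noteq> 0"
proof
  assume root: "pC (\<lambda>i. of_real (vec_nth x i) + t * of_real (vec_nth e i) + s * of_real (vec_nth u i)) = 0"
  define y where "y = x + Re t *\<^sub>R e"
  define \<delta> where "\<delta> = Im t"
  have "\<delta> > 0" using t by (simp add: \<delta>_def)
  define w where "w = (\<lambda>(\<tau>::real) i. of_real \<tau> * of_real (vec_nth y i) + \<i> * of_real \<delta> * of_real (vec_nth e i))"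
  define Q where "Q = (\<lambda>\<tau> s. pC (\<lambda>i. w \<tau> i + s * of_real (vec_nth u i)))"
  define R where "R = (\<lambda>\<tau> r. pC (\<lambda>i. r * w \<tau> i + of_real (vec_nth u i)))"
  define A where "A = {\<tau>. \<exists>s. Im s \<ge> 0 \<and> Q \<tau> s = 0}"
  have pu: "p u > 0" using u by (rule p_pos_on_open_hcone)
  have R_Q: "R \<tau> r = r ^ d * Q \<tau> (1 / r)" if "r \<noteq> 0" for \<tau> r
  proof -
    have "(\<lambda>i. r * w \<tau> i + of_real (vec_nth u i)) = (\<lambda>i. r * (w \<tau> i + 1 / r * of_real (vec_nth u i)))"
      by (rule ext) (use that in \<open>simp add: field_simps\<close>)
    then show ?thesis by (simp add: R_def Q_def pC_scale)
  qed
  have nonreal: "Im s \<noteq> 0" if "Q \<tau> s = 0" for \<tau> s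
    using pC_nonzero_of_real_s[of s \<delta> "\<tau> *\<^sub>R y" u] that \<open>\<delta> > 0\<close> by (auto simp: Q_def w_def)
  have "0 \<notin> A"
    using pC_root_Im_neg_at_0[OF u \<open>\<delta> > 0\<close>] by (force simp: A_def Q_def w_def)
  moreover have "1 \<in> A"
  proof -
    have "(\<lambda>i. w 1 i + s * of_real (vec_nth u i)) =
        (\<lambda>i. of_real (vec_nth x i) + t * of_real (vec_nth e i) + s * of_real (vec_nth u i))"
      using complex_eq[of t] by (auto simp: w_def y_def \<delta>_def fun_eq_iff algebra_simps complex_eq_iff)
    then show ?thesis using root s by (auto simp: A_def Q_def)
  qed
  \<comment> \<open>Near \<open>\<tau>0\<close> there is a zero at distance less than \<open>Im s0\<close> from \<open>s0\<close>.\<close>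
  moreover have "open A"
  proof (subst open_subopen, intro ballI)
    fix \<tau>0 assume "\<tau>0 \<in> A"
    then obtain s0 where s0: "Im s0 \<ge> 0" "Q \<tau>0 s0 = 0" by (auto simp: A_def)
    then have "Im s0 > 0" using nonreal by force
    define T where "T = {\<tau>. norm (Q \<tau> s0) < p u * Im s0 ^ d}"
    have "open T"
      unfolding T_def Q_def pC_def w_def by (intro open_Collect_less continuous_intros)
    moreover have "\<tau>0 \<in> T" using s0 pu \<open>Im s0 > 0\<close> by (simp add: T_def)
    moreover have "T \<subseteq> A"
    proof
      fix \<tau> assume \<tau>: "\<tau> \<in> T"
      define q where "q = line_form d c (w \<tau>) (\<lambda>i. complex_of_real (vec_nth u i))"
      have poly_q: "poly q s = Q \<tau> s" for s by (simp add: q_def poly_line_form Q_def pC_def)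
      have co: "coeff q d = of_real (p u)"
        by (simp add: q_def coeff_line_form_top pC_of_real[symmetric] pC_def)
      have deg: "degree q = d"
        by (rule antisym) (use co pu in \<open>auto intro: le_degree simp: q_def degree_line_form_le\<close>)
      have "\<not> (\<forall>s. poly q s = 0 \<longrightarrow> Im s0 \<le> norm (s0 - s))"
      proof
        assume "\<forall>s. poly q s = 0 \<longrightarrow> Im s0 \<le> norm (s0 - s)"
        then have "norm (lead_coeff q) * Im s0 ^ degree q \<le> norm (poly q s0)"
          using \<open>Im s0 > 0\<close> by (intro norm_poly_ge_of_roots_far) auto
        then show False using \<tau> pu by (simp add: deg co poly_q T_def)
      qed
      then obtain s where s: "Q \<tau> s = 0" "norm (s0 - s) < Im s0" by (auto simp: poly_q not_le)
      have "Im s0 - Im s \<le> norm (s0 - s)" using abs_Im_le_cmod[of "s0 - s"] by simp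
      then show "\<tau> \<in> A" using s by (auto simp: A_def intro!: exI[of _ s])
    qed
    ultimately show "\<exists>T. open T \<and> \<tau>0 \<in> T \<and> T \<subseteq> A" by blast
  qed
  \<comment> \<open>The zeros range over a compact set after the substitution \<open>r = 1 / s\<close> outside the unit disc; the value
  \<open>r = 0\<close> does not occur because \<open>p u \<noteq> 0\<close>.\<close>
  moreover have "closed A"
  proof -
    have "A = {\<tau>. \<exists>s. s \<in> cball 0 1 \<inter> {s. Im s \<ge> 0} \<and> (s, \<tau>) \<in> {z. Q (snd z) (fst z) = 0}}
        \<union> {\<tau>. \<exists>r. r \<in> cball 0 1 \<inter> {r. Im r \<le> 0} \<and> (r, \<tau>) \<in> {z. R (snd z) (fst z) = 0}}"
      (is "_ = ?A \<union> ?B")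
    proof (intro equalityI subsetI)
      fix \<tau> assume "\<tau> \<in> A"
      then obtain s where s: "Im s \<ge> 0" "Q \<tau> s = 0" by (auto simp: A_def)
      show "\<tau> \<in> ?A \<union> ?B"
      proof (cases "norm s \<le> 1")
        case False
        then have "s \<noteq> 0" by auto
        then have "R \<tau> (1 / s) = 0" using s by (simp add: R_Q)
        moreover have "norm (1 / s) \<le> 1" using False by (simp add: norm_divide divide_simps)
        moreover have "Im (1 / s) \<le> 0" using s by (simp add: Im_divide divide_nonpos_nonneg)
        ultimately show ?thesis by (intro UnI2 CollectI exI[of _ "1 / s"]) simp
      qed (use s in auto)
    next
      fix \<tau> assume "\<tau> \<in> ?A \<union> ?B"
      then show "\<tau> \<in> A"
      proof
        assume "\<tau> \<in> ?B"
        then obtain r where r: "Im r \<le> 0" "R \<tau> r = 0" by auto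
        have "r \<noteq> 0" using r pu by (auto simp: R_def pC_of_real)
        then have "Q \<tau> (1 / r) = 0" using r R_Q[of r \<tau>] by simp
        moreover have "Im (1 / r) \<ge> 0" using r by (simp add: Im_divide divide_nonpos_nonneg)
        ultimately show ?thesis by (auto simp: A_def)
      qed (auto simp: A_def)
    qed
    moreover have "closed ?A"
      unfolding Q_def pC_def w_def
      by (intro closed_compact_projection compact_Int_closed compact_cball closed_Collect_le closed_Collect_eq continuous_intros)
    moreover have "closed ?B"
      unfolding R_def pC_def w_def
      by (intro closed_compact_projection compact_Int_closed compact_cball closed_Collect_le closed_Collect_eq continuous_intros)
    ultimately show ?thesis by (simp only: closed_Un)
  qed
  ultimately show False using clopen[of A] by auto
qed

section \<open>Residues along lines in the direction of hyperbolicity\<close>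

lemma directional_deriv_eq: "directional_deriv p u x = dform of_real d c (vec_nth x) (vec_nth u)"
proof -
  have "(p has_derivative (\<lambda>u. dform of_real d c (vec_nth x) (vec_nth u))) (at x)"
    using has_derivative_form[of d c x] by (simp add: p_eq[abs_def])
  then show ?thesis
    by (simp add: directional_deriv_def frechet_derivative_at[symmetric])
qed

lemma has_derivative_p: "(p has_derivative (\<lambda>u. directional_deriv p u x)) (at x)"
  unfolding directional_deriv_eq using has_derivative_form[of d c x] by (simp add: p_eq[abs_def])

lemma line_poly_deriv:
  "line_poly (directional_deriv p u) x e = line_dform d c (vec_nth x) (vec_nth e) (vec_nth u)"
  by (rule line_poly_eqI) (simp add: poly_line_dform directional_deriv_eq vec_nth_line)

lemma cpoly_line_poly_deriv:
  "cpoly (line_poly (directional_deriv p u) x e)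
     = line_dform d c (\<lambda>i. of_real (vec_nth x i)) (\<lambda>i. of_real (vec_nth e i)) (\<lambda>i. of_real (vec_nth u i))"
  by (rule map_poly_of_real_eqI)
     (simp add: line_poly_deriv poly_line_dform dform_of_real[symmetric] del: of_real_eq_id)

lemma Im_logderiv_line_nonpos:
  assumes u: "u \<in> open_hcone" and t: "Im t > 0"
  shows "Im (poly (cpoly (line_poly (directional_deriv p u) x e)) t / poly (cpoly (line_poly p x e)) t) \<le> 0"
proof -
  let ?w = "\<lambda>i. of_real (vec_nth x i) + t * of_real (vec_nth e i) :: complex"
  define q where "q = line_form d c ?w (\<lambda>i. complex_of_real (vec_nth u i))"
  have "Im (poly (pderiv q) 0 / poly q 0) \<le> 0"
  proof (rule Im_logderiv_nonpos)
    fix s assume "poly q s = 0"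
    then show "Im s < 0"
      using pC_stable[OF u t, of s x] by (cases "Im s \<ge> 0") (auto simp: q_def poly_line_form pC_def)
  qed
  moreover have "poly q 0 = poly (cpoly (line_poly p x e)) t"
    by (simp add: q_def poly_line_form poly_cpoly_line_poly pC_def)
  moreover have "poly (pderiv q) 0 = poly (cpoly (line_poly (directional_deriv p u) x e)) t"
    by (simp add: q_def line_form_def pderiv_form poly_dform pderiv_pCons cpoly_line_poly_deriv poly_line_dform)
  ultimately show ?thesis by simp
qed

text \<open>
  The distinct zeros of \<open>t \<mapsto> p (x + t e)\<close>.
\<close>

definition line_roots :: "real ^ 'n \<Rightarrow> real set" where
  "line_roots x = {a. p (x + a *\<^sub>R e) = 0}"

lemma poly_line_p: "poly (line_poly p x e) t = p (x + t *\<^sub>R e)"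
  by (simp add: line_poly_p poly_line_form p_eq vec_nth_line)

lemma line_poly_nonzero: "line_poly p x e \<noteq> 0"
  using line_poly_lead_coeff[of e x] p_e_pos by auto

lemma line_roots_eq: "line_roots x = {a. poly (line_poly p x e) a = 0}"
  by (simp add: line_roots_def poly_line_p)

lemma finite_line_roots: "finite (line_roots x)"
  unfolding line_roots_eq by (rule poly_roots_finite[OF line_poly_nonzero])

lemma card_line_roots: "card (line_roots x) \<le> d"
  unfolding line_roots_eq
  using card_poly_roots_bound[OF line_poly_nonzero, of x] line_poly_degree[of e x] p_e_pos by simp

text \<open>
  For \<open>u\<close> in the open cone, the residues \<open>k a\<close> of \<open>D\<^sub>u p (x + t e) / p (x + t e)\<close> are nonnegative.  They
  determine the Hermite coefficients as well as the values of this rational function.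
\<close>

lemma hermite_residues:
  assumes u: "u \<in> open_hcone"
  obtains k where "\<And>a. a \<in> line_roots x \<Longrightarrow> k a \<ge> 0"
    "\<And>n. hermite_coeff p e x u (Suc n) = (\<Sum>a\<in>line_roots x. k a * a ^ n)"
    "\<And>t. t \<notin> line_roots x \<Longrightarrow>
       directional_deriv p u (x + t *\<^sub>R e) / p (x + t *\<^sub>R e) = (\<Sum>a\<in>line_roots x. k a / (t - a))"
proof -
  let ?f = "line_poly (directional_deriv p u) x e" and ?g = "line_poly p x e"
  have "?f = 0 \<or> degree ?f < degree ?g"
  proof (cases "d = 0")
    case True
    then show ?thesis by (simp add: line_poly_deriv line_dform_def dform_degree_0)
  next
    case False
    then show ?thesis
      using degree_line_dform_le[of d c "vec_nth x" "vec_nth e" "vec_nth u"] line_poly_degree[of e x] p_e_pos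
      unfolding line_poly_deriv by linarith
  qed
  note pf = partial_fractions_of_Im_nonpos[OF line_poly_nonzero line_real_rooted this
      Im_logderiv_line_nonpos[OF u], folded line_roots_eq]
  show thesis
  proof (rule pf)
    fix k
    assume k: "\<And>a. a \<in> line_roots x \<Longrightarrow> k a \<ge> 0"
      and eq: "?f * (\<Prod>a\<in>line_roots x. [:- a, 1:]) =
         ?g * (\<Sum>a\<in>line_roots x. Polynomial.smult (k a) (lagrange_basis (line_roots x) a))"
    show thesis
    proof (rule that[OF k])
      fix n
      have "fls_nth (\<Sum>a\<in>line_roots x. fls_const (k a) * geometric_fls a) (int (Suc n))
          = (\<Sum>a\<in>line_roots x. fls_nth (fls_const (k a) * geometric_fls a) (int (Suc n)))"
        by (induction rule: finite_induct[OF finite_line_roots[of x]]) auto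
      then show "hermite_coeff p e x u (Suc n) = (\<Sum>a\<in>line_roots x. k a * a ^ n)"
        unfolding hermite_coeff_def
          expansion_at_infinity_partial_fractions[OF finite_line_roots line_poly_nonzero eq]
        by (simp del: of_nat_Suc)
    next
      fix t assume t: "t \<notin> line_roots x"
      then have "poly ?g t \<noteq> 0" by (simp add: line_roots_eq)
      from eval_partial_fractions[OF finite_line_roots this t eq]
      show "directional_deriv p u (x + t *\<^sub>R e) / p (x + t *\<^sub>R e) = (\<Sum>a\<in>line_roots x. k a / (t - a))"
        by (simp add: poly_line_p line_poly_deriv poly_line_dform directional_deriv_eq vec_nth_line)
    qed
  qed
qed

section \<open>The functionals defined by Hermite matrices\<close>

lemma line_poly_deriv_add:
  "line_poly (directional_deriv p (u + v)) x e
     = line_poly (directional_deriv p u) x e + line_poly (directional_deriv p v) x e"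
proof -
  have "(\<lambda>i. [:vec_nth (u + v) i:]) = (\<lambda>i. [:vec_nth u i:] + [:vec_nth v i:])" by auto
  then show ?thesis by (simp only: line_poly_deriv line_dform_def dform_add)
qed

lemma line_poly_deriv_scaleR:
  "line_poly (directional_deriv p (k *\<^sub>R u)) x e = Polynomial.smult k (line_poly (directional_deriv p u) x e)"
proof -
  have "(\<lambda>i. [:vec_nth (k *\<^sub>R u) i:]) = (\<lambda>i. [:k:] * [:vec_nth u i:])" by auto
  then show ?thesis by (simp only: line_poly_deriv line_dform_def dform_scale) simp
qed

lemma hermite_coeff_add: "hermite_coeff p e x (u + v) n = hermite_coeff p e x u n + hermite_coeff p e x v n"
  by (simp add: hermite_coeff_def expansion_at_infinity_def at_inf_def[symmetric]
      line_poly_deriv_add at_inf_add add_divide_distrib)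

lemma hermite_coeff_scaleR: "hermite_coeff p e x (k *\<^sub>R u) n = k * hermite_coeff p e x u n"
  by (simp add: hermite_coeff_def expansion_at_infinity_def at_inf_def[symmetric]
      line_poly_deriv_scaleR at_inf_smult times_divide_eq_right[symmetric] del: times_divide_eq_right)

lemma hermite_functional_apply:
  assumes "y \<in> carrier_vec d"
  shows "blinfun_apply (hermite_functional d p e x y) u = scalar_prod y (hermite_matrix d p e x u *\<^sub>v y)"
proof -
  have "linear (\<lambda>u. scalar_prod y (hermite_matrix d p e x u *\<^sub>v y))"
    unfolding hermite_matrix_def hankel_form_eq_sum[OF assms]
    by (rule linearI)
       (simp_all add: hermite_coeff_add hermite_coeff_scaleR sum_distrib_left sum.distrib algebra_simps)
  then have "bounded_linear (\<lambda>u. scalar_prod y (hermite_matrix d p e x u *\<^sub>v y))"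
    by (simp add: linear_conv_bounded_linear)
  then show ?thesis
    by (simp add: hermite_functional_def bounded_linear_Blinfun_apply)
qed

lemma hermite_functional_eq_sum_squares:
  assumes y: "y \<in> carrier_vec d"
    and k: "\<And>n. hermite_coeff p e x u (Suc n) = (\<Sum>a\<in>line_roots x. k a * a ^ n)"
  shows "blinfun_apply (hermite_functional d p e x y) u
      = (\<Sum>a\<in>line_roots x. k a * (\<Sum>i<d. vec_index y i * a ^ i)\<^sup>2)"
  unfolding hermite_functional_apply[OF y] hermite_matrix_def
  by (rule hankel_form_eq_sum_squares[OF y k])

lemma mem_dual_hconeI:
  assumes "\<And>u. u \<in> open_hcone \<Longrightarrow> blinfun_apply \<xi> u \<ge> 0"
  shows "\<xi> \<in> dual_cone hcone"
  unfolding dual_cone_def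
proof (intro CollectI ballI)
  fix u assume u: "u \<in> hcone"
  have "((\<lambda>\<epsilon>. blinfun_apply \<xi> (u + \<epsilon> *\<^sub>R e)) \<longlongrightarrow> blinfun_apply \<xi> (u + 0 *\<^sub>R e)) (at_right 0)"
    by (intro tendsto_intros)
  moreover have "\<forall>\<^sub>F \<epsilon> in at_right 0. 0 \<le> blinfun_apply \<xi> (u + \<epsilon> *\<^sub>R e)"
    unfolding eventually_at_right_field using assms hcone_add_e[OF u] by (intro exI[of _ 1]) auto
  ultimately have "0 \<le> blinfun_apply \<xi> (u + 0 *\<^sub>R e)"
    by (rule tendsto_lowerbound) simp
  then show "0 \<le> blinfun_apply \<xi> u" by simp
qed

text \<open>
  The open cone spans the space.
\<close>

lemma blinfun_eqI_open_hcone: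
  fixes \<xi> \<eta> :: "(real ^ 'n) \<Rightarrow>\<^sub>L real"
  assumes "\<And>u. u \<in> open_hcone \<Longrightarrow> blinfun_apply \<xi> u = blinfun_apply \<eta> u"
  shows "\<xi> = \<eta>"
proof (rule blinfun_eqI)
  fix u
  have "\<exists>t. u + t *\<^sub>R e \<in> open_hcone"
    using eventually_happens[OF eventually_in_open_hcone[of u]] by simp
  then obtain t where "u + t *\<^sub>R e \<in> open_hcone" by blast
  then have "blinfun_apply \<xi> (u + t *\<^sub>R e) = blinfun_apply \<eta> (u + t *\<^sub>R e)" by (rule assms)
  then show "blinfun_apply \<xi> u = blinfun_apply \<eta> u"
    using assms[OF e_in_open_hcone] by (simp add: blinfun.add_right blinfun.scaleR_right)
qed

lemma hermite_functional_in_dual_cone: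
  assumes "y \<in> carrier_vec d"
  shows "hermite_functional d p e x y \<in> dual_cone hcone"
proof (rule mem_dual_hconeI)
  fix u assume u: "u \<in> open_hcone"
  obtain k where k:
      "\<And>a. a \<in> line_roots x \<Longrightarrow> k a \<ge> 0"
      "\<And>n. hermite_coeff p e x u (Suc n) = (\<Sum>a\<in>line_roots x. k a * a ^ n)"
      "\<And>t. t \<notin> line_roots x \<Longrightarrow>
         directional_deriv p u (x + t *\<^sub>R e) / p (x + t *\<^sub>R e) = (\<Sum>a\<in>line_roots x. k a / (t - a))"
    by (rule hermite_residues[OF u, of x]) blast
  then show "0 \<le> blinfun_apply (hermite_functional d p e x y) u"
    by (simp add: hermite_functional_eq_sum_squares[OF assms k(2)] sum_nonneg)
qed

lemma line_roots_neg: "x \<in> open_hcone \<Longrightarrow> a \<in> line_roots x \<Longrightarrow> a < 0"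
  by (auto simp: open_hcone_def line_roots_def) (meson not_le)

lemma directional_deriv_nonneg:
  assumes "x \<in> open_hcone" "u \<in> open_hcone"
  shows "directional_deriv p u x \<ge> 0"
proof -
  have neg: "a < 0" if "a \<in> line_roots x" for a using line_roots_neg[OF assms(1) that] .
  obtain k where k:
      "\<And>a. a \<in> line_roots x \<Longrightarrow> k a \<ge> 0"
      "\<And>n. hermite_coeff p e x u (Suc n) = (\<Sum>a\<in>line_roots x. k a * a ^ n)"
      "\<And>t. t \<notin> line_roots x \<Longrightarrow>
         directional_deriv p u (x + t *\<^sub>R e) / p (x + t *\<^sub>R e) = (\<Sum>a\<in>line_roots x. k a / (t - a))"
    by (rule hermite_residues[OF assms(2), of x]) blast
  have "directional_deriv p u x / p x = (\<Sum>a\<in>line_roots x. k a / (0 - a))"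
    using k(3)[of 0] neg[of 0] by auto
  also have "\<dots> \<ge> 0" by (intro sum_nonneg divide_nonneg_pos k(1)) (use neg in auto)
  finally show ?thesis
    using p_pos_on_open_hcone[OF assms(1)] by (simp add: zero_le_divide_iff)
qed

lemma bounded_linear_directional_deriv: "bounded_linear (\<lambda>u. directional_deriv p u x)"
  using has_derivative_p by (rule has_derivative_bounded_linear)

lemma gradient_in_dual_cone:
  assumes "x \<in> open_hcone"
  shows "Blinfun (\<lambda>u. directional_deriv p u x) \<in> dual_cone hcone"
  by (rule mem_dual_hconeI)
     (simp add: bounded_linear_Blinfun_apply bounded_linear_directional_deriv directional_deriv_nonneg assms)

text \<open>
  The vector \<open>y\<close> consists of the coefficients of a polynomial \<open>q\<close> with \<open>q(a)\<^sup>2 = 1 / (- d a)\<close> at all the zeros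
  \<open>a\<close>, which are negative.  The sum of the \<open>k a / (- a)\<close> is the value at \<open>t = 0\<close> of the partial fraction
  decomposition.
\<close>

lemma gradient_in_hermite_image:
  assumes "d > 0" and x: "x \<in> open_hcone"
    and grad: "\<And>u. directional_deriv p u x = p x * (real d * blinfun_apply \<xi> u)"
  obtains y where "y \<in> carrier_vec d" "hermite_functional d p e x y = \<xi>"
proof -
  have neg: "a < 0" if "a \<in> line_roots x" for a using line_roots_neg[OF x that] .
  obtain q where q: "\<And>a. a \<in> line_roots x \<Longrightarrow> poly q a = sqrt (1 / (real d * - a))"
    "\<And>i. card (line_roots x) \<le> i \<Longrightarrow> coeff q i = 0"
    by (rule interpolating_poly[OF finite_line_roots[of x], of "\<lambda>a. sqrt (1 / (real d * - a))"]) blast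
  define y where "y = vec d (coeff q)"
  have y: "y \<in> carrier_vec d" by (simp add: y_def)
  have eval: "(\<Sum>i<d. vec_index y i * a ^ i) = poly q a" for a
  proof -
    have "(\<Sum>i<d. vec_index y i * a ^ i) = (\<Sum>i<d. coeff q i * a ^ i)"
      by (simp add: y_def)
    also have "\<dots> = (\<Sum>i\<le>degree q. coeff q i * a ^ i)"
    proof (rule sum.mono_neutral_cong)
      show "coeff q i * a ^ i = 0" if "i \<in> {..degree q} - {..<d}" for i
        using that q(2)[of i] card_line_roots[of x] by simp
      show "coeff q i * a ^ i = 0" if "i \<in> {..<d} - {..degree q}" for i
        using that by (simp add: coeff_eq_0)
    qed auto
    finally show ?thesis by (simp add: poly_altdef)
  qed
  have "hermite_functional d p e x y = \<xi>"
  proof (rule blinfun_eqI_open_hcone)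
    fix u assume u: "u \<in> open_hcone"
    obtain k where k:
      "\<And>a. a \<in> line_roots x \<Longrightarrow> k a \<ge> 0"
      "\<And>n. hermite_coeff p e x u (Suc n) = (\<Sum>a\<in>line_roots x. k a * a ^ n)"
      "\<And>t. t \<notin> line_roots x \<Longrightarrow>
         directional_deriv p u (x + t *\<^sub>R e) / p (x + t *\<^sub>R e) = (\<Sum>a\<in>line_roots x. k a / (t - a))"
      by (rule hermite_residues[OF u, of x]) blast
    have "blinfun_apply (hermite_functional d p e x y) u = (\<Sum>a\<in>line_roots x. k a * (poly q a)\<^sup>2)"
      by (simp add: hermite_functional_eq_sum_squares[OF y k(2)] eval)
    also have "\<dots> = (\<Sum>a\<in>line_roots x. 1 / real d * (k a / (0 - a)))"
    proof (rule sum.cong)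
      fix a assume a: "a \<in> line_roots x"
      then have "0 \<le> 1 / (real d * - a)" using neg[of a] by (simp add: zero_le_divide_iff mult_le_0_iff)
      then have "(poly q a)\<^sup>2 = 1 / (real d * - a)" unfolding q(1)[OF a] by (rule real_sqrt_pow2)
      then show "k a * (poly q a)\<^sup>2 = 1 / real d * (k a / (0 - a))" by simp
    qed simp
    also have "\<dots> = 1 / real d * (directional_deriv p u x / p x)"
    proof -
      have "directional_deriv p u x / p x = (\<Sum>a\<in>line_roots x. k a / (0 - a))"
        using k(3)[of 0] neg[of 0] by auto
      then show ?thesis by (simp only: sum_distrib_left)
    qed
    also have "\<dots> = blinfun_apply \<xi> u"
      using p_pos_on_open_hcone[OF x] \<open>d > 0\<close> by (simp add: grad)
    finally show "blinfun_apply (hermite_functional d p e x y) u = blinfun_apply \<xi> u" .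
  qed
  with y show thesis by (rule that)
qed

lemma DERIV_p_line: "((\<lambda>s. p (x + s *\<^sub>R u)) has_real_derivative directional_deriv p u (x + s *\<^sub>R u)) (at s)"
proof -
  have "((\<lambda>s. x + s *\<^sub>R u) has_derivative (\<lambda>h. h *\<^sub>R u)) (at s)"
    by (auto intro!: derivative_eq_intros)
  from has_derivative_compose[OF this has_derivative_p]
  have "((\<lambda>s. p (x + s *\<^sub>R u)) has_derivative (\<lambda>h. directional_deriv p (h *\<^sub>R u) (x + s *\<^sub>R u))) (at s)" .
  moreover have "(\<lambda>h. directional_deriv p (h *\<^sub>R u) z) = (*) (directional_deriv p u z)" for z
    by (auto simp: directional_deriv_eq vec_nth_scaleR dform_scale)
  ultimately show ?thesis by (simp add: has_field_derivative_def)
qed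

section \<open>The relative interior of the dual cone\<close>

text \<open>
  The common kernel of all functionals in the dual cone.  It turns out that \<open>p\<close> is constant along its
  directions, because the gradients of \<open>p\<close> at points of the open cone belong to the dual cone.
\<close>

definition dual_annihilator :: "(real ^ 'n) set" where
  "dual_annihilator = {w. \<forall>\<eta>\<in>dual_cone hcone. blinfun_apply \<eta> w = 0}"

lemma subspace_dual_annihilator: "subspace dual_annihilator"
  by (auto simp: subspace_def dual_annihilator_def blinfun.add_right blinfun.scaleR_right)

lemma directional_deriv_annihilator:
  assumes w: "w \<in> dual_annihilator"
  shows "directional_deriv p w x = 0"
proof -
  let ?q = "line_poly (directional_deriv p w) x e"
  have eval: "poly ?q t = directional_deriv p w (x + t *\<^sub>R e)" for t
    by (simp add: line_poly_deriv poly_line_dform directional_deriv_eq vec_nth_line)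
  have "\<forall>\<^sub>F t in at_top. poly ?q t = 0"
    using eventually_in_open_hcone[of x]
  proof eventually_elim
    case (elim t)
    from gradient_in_dual_cone[OF this] w show ?case
      by (auto simp: dual_annihilator_def eval bounded_linear_Blinfun_apply bounded_linear_directional_deriv)
  qed
  then obtain N where "\<And>t. t \<ge> N \<Longrightarrow> poly ?q t = 0" unfolding eventually_at_top_linorder by blast
  then have "{N..} \<subseteq> {t. poly ?q t = 0}" by auto
  then have "\<not> finite {t. poly ?q t = 0}" using infinite_Ici finite_subset by blast
  then have "?q = 0" using poly_roots_finite by blast
  then show ?thesis using eval[of 0] by simp
qed

lemma p_annihilator_invariant:
  assumes "w \<in> dual_annihilator"
  shows "p (x + w) = p x"
proof -
  have "\<forall>s. ((\<lambda>s. p (x + s *\<^sub>R w)) has_real_derivative 0) (at s)"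
    using DERIV_p_line[of x w] by (simp add: directional_deriv_annihilator[OF assms])
  from DERIV_isconst_all[OF this, of 1 0] show ?thesis by simp
qed

lemma hcone_annihilator_invariant:
  assumes "w \<in> dual_annihilator" "x \<in> hcone"
  shows "x + w \<in> hcone"
  unfolding mem_hcone_iff
proof (intro allI impI)
  fix t :: real assume "t > 0"
  have "p (x + w + t *\<^sub>R e) = p (x + t *\<^sub>R e)"
    using p_annihilator_invariant[OF assms(1), of "x + t *\<^sub>R e"] by (simp add: algebra_simps)
  then show "p (x + w + t *\<^sub>R e) \<noteq> 0" using assms(2) \<open>t > 0\<close> by (simp add: mem_hcone_iff)
qed

text \<open>
  On the orthogonal complement of the common kernel, a functional in the relative interior grows at least
  linearly along the cone.
\<close>

lemma rel_interior_dual_cone_coercive: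
  assumes \<xi>: "\<xi> \<in> rel_interior (dual_cone hcone)"
    and K: "K = hcone \<inter> {x. \<forall>w\<in>dual_annihilator. inner x w = 0}"
  obtains m where "m > 0" "\<And>x. x \<in> K \<Longrightarrow> m * norm x \<le> blinfun_apply \<xi> x"
proof -
  have "closed K"
    unfolding K by (intro closed_Int closed_hcone closed_orthogonal_set)
  then have "compact (K \<inter> sphere 0 1)" by (intro closed_Int_compact) auto
  have pos: "blinfun_apply \<xi> x > 0" if "x \<in> K" "x \<noteq> 0" for x
  proof -
    have "\<xi> \<in> dual_cone hcone" using \<xi> rel_interior_subset by blast
    then have "0 \<le> blinfun_apply \<xi> x" using that by (auto simp: dual_cone_def K)
    moreover have "blinfun_apply \<xi> x \<noteq> 0"
    proof
      assume "blinfun_apply \<xi> x = 0"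
      then have "x \<in> dual_annihilator"
        using rel_interior_dual_cone_vanish[OF \<xi>, of x] that by (auto simp: dual_annihilator_def K)
      then have "inner x x = 0" using that by (auto simp: K)
      then show False using that by simp
    qed
    ultimately show ?thesis by simp
  qed
  obtain m where m: "m > 0" "\<And>x. x \<in> K \<inter> sphere 0 1 \<Longrightarrow> m \<le> blinfun_apply \<xi> x"
  proof (cases "K \<inter> sphere 0 1 = {}")
    case True
    then show thesis by (intro that[of 1]) auto
  next
    case False
    have "continuous_on (K \<inter> sphere 0 1) (blinfun_apply \<xi>)" by (intro continuous_intros)
    from continuous_attains_inf[OF \<open>compact (K \<inter> sphere 0 1)\<close> False this]
    obtain x1 where "x1 \<in> K \<inter> sphere 0 1" "\<And>x. x \<in> K \<inter> sphere 0 1 \<Longrightarrow> blinfun_apply \<xi> x1 \<le> blinfun_apply \<xi> x"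
      by blast
    then show thesis by (intro that[of "blinfun_apply \<xi> x1"] pos) auto
  qed
  show thesis
  proof (rule that[OF m(1)])
    fix x assume x: "x \<in> K"
    show "m * norm x \<le> blinfun_apply \<xi> x"
    proof (cases "x = 0")
      case False
      then have "(1 / norm x) *\<^sub>R x \<in> K \<inter> sphere 0 1"
        using x by (auto simp: K hcone_scale)
      from m(2)[OF this] show ?thesis using False by (simp add: blinfun.scaleR_right field_simps)
    qed simp
  qed
qed

text \<open>
  The point \<open>x\<close> maximises \<open>p\<close> on the slice \<open>\<xi> = 1\<close> of the cone.  It suffices to maximise over the
  compact part \<open>B\<close> of the slice that is orthogonal to the common kernel.  By homogeneity,
  \<open>p - p(x) \<xi>\<^sup>d\<close> then has a local maximum at \<open>x\<close>, so that its derivative vanishes there.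
\<close>

lemma rel_interior_dual_cone_gradient:
  assumes "d > 0" and \<xi>: "\<xi> \<in> rel_interior (dual_cone hcone)"
  obtains x where "x \<in> open_hcone" "\<And>u. directional_deriv p u x = p x * (real d * blinfun_apply \<xi> u)"
proof -
  define V where "V = {x. \<forall>w\<in>dual_annihilator. inner x w = 0}"
  define K where "K = hcone \<inter> V"
  have \<xi>_dual: "\<xi> \<in> dual_cone hcone" using \<xi> rel_interior_subset by blast
  obtain m where m: "m > 0" "\<And>x. x \<in> K \<Longrightarrow> m * norm x \<le> blinfun_apply \<xi> x"
    using rel_interior_dual_cone_coercive[OF \<xi> K_def[unfolded V_def]] by blast
  have project: "\<exists>v\<in>K. p v = p x \<and> blinfun_apply \<xi> v = blinfun_apply \<xi> x" if x: "x \<in> hcone" for x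
  proof -
    obtain w v where wv: "w \<in> span dual_annihilator" "\<And>w. w \<in> span dual_annihilator \<Longrightarrow> inner v w = 0" "x = w + v"
      by (rule orthogonal_subspace_decomp_exists[of dual_annihilator x, unfolded Linear_Algebra.orthogonal_def]) blast
    then have w: "w \<in> dual_annihilator" and "v \<in> V"
      by (auto simp: span_eq_iff[THEN iffD2, OF subspace_dual_annihilator] V_def)
    have v: "v = x + (- w)" using wv by simp
    have w': "- w \<in> dual_annihilator" using subspace_neg[OF subspace_dual_annihilator w] .
    have "blinfun_apply \<xi> w = 0" using w \<xi>_dual by (auto simp: dual_annihilator_def)
    then have "blinfun_apply \<xi> v = blinfun_apply \<xi> x" by (simp add: v blinfun.diff_right)
    moreover have "v \<in> K" using \<open>v \<in> V\<close> hcone_annihilator_invariant[OF w' x] by (simp add: K_def v)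
    moreover have "p v = p x" unfolding v by (rule p_annihilator_invariant[OF w'])
    ultimately show ?thesis by blast
  qed
  define B where "B = K \<inter> {x. blinfun_apply \<xi> x = 1}"
  have "compact B"
    unfolding compact_eq_bounded_closed
  proof
    show "closed B"
      unfolding B_def K_def V_def
      by (intro closed_Int closed_hcone closed_orthogonal_set closed_Collect_eq continuous_intros)
    have "norm x \<le> 1 / m" if "x \<in> B" for x
      using m(2)[of x] m(1) that by (auto simp: B_def field_simps)
    then show "bounded B" by (auto simp: bounded_iff)
  qed
  have normalise: "\<exists>b\<in>B. p b = p x / blinfun_apply \<xi> x ^ d" if x: "x \<in> hcone" and pos: "blinfun_apply \<xi> x > 0" for x
  proof -
    obtain v where v: "v \<in> K" "p v = p x" "blinfun_apply \<xi> v = blinfun_apply \<xi> x" using project[OF x] by blast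
    show ?thesis
    proof
      show "p ((1 / blinfun_apply \<xi> x) *\<^sub>R v) = p x / blinfun_apply \<xi> x ^ d"
        by (simp add: p_scale v power_divide)
      show "(1 / blinfun_apply \<xi> x) *\<^sub>R v \<in> B"
        using v pos by (auto simp: B_def K_def V_def hcone_scale blinfun.scaleR_right)
    qed
  qed
  have e: "e \<in> hcone" using e_in_open_hcone open_hcone_subset by blast
  have "blinfun_apply \<xi> e > 0"
  proof -
    have "0 \<le> blinfun_apply \<xi> e" using \<xi>_dual e by (simp add: dual_cone_def)
    moreover have "blinfun_apply \<xi> e \<noteq> 0"
    proof
      assume "blinfun_apply \<xi> e = 0"
      then have "e \<in> dual_annihilator"
        using rel_interior_dual_cone_vanish[OF \<xi> e] by (simp add: dual_annihilator_def)
      then have "p (0 + e) = p 0" by (rule p_annihilator_invariant)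
      moreover have "p 0 = 0" using p_scale[of 0 0] \<open>d > 0\<close> by (simp add: zero_power)
      ultimately show False using p_e_pos by simp
    qed
    ultimately show ?thesis by simp
  qed
  from normalise[OF e this] obtain b where b: "b \<in> B" "p b = p e / blinfun_apply \<xi> e ^ d" by blast
  have "p b > 0" using b p_e_pos \<open>blinfun_apply \<xi> e > 0\<close> by simp
  have "B \<noteq> {}" using b by auto
  have "continuous_on B p" using continuous_on_p[of B "\<lambda>x. x"] by simp
  from continuous_attains_sup[OF \<open>compact B\<close> \<open>B \<noteq> {}\<close> this]
  obtain x0 where x0: "x0 \<in> B" "\<And>x. x \<in> B \<Longrightarrow> p x \<le> p x0" by blast
  have "p x0 > 0" using x0(2)[OF b(1)] \<open>p b > 0\<close> by simp
  have "x0 \<in> hcone" "blinfun_apply \<xi> x0 = 1" using x0 by (auto simp: B_def K_def)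
  have x0_open: "x0 \<in> open_hcone" using hcone_p_nonzero \<open>x0 \<in> hcone\<close> \<open>p x0 > 0\<close> by simp
  have max: "p x \<le> p x0 * blinfun_apply \<xi> x ^ d" if x: "x \<in> hcone" and pos: "blinfun_apply \<xi> x > 0" for x
  proof -
    obtain b where "b \<in> B" "p b = p x / blinfun_apply \<xi> x ^ d" using normalise[OF x pos] by blast
    then have "p x / blinfun_apply \<xi> x ^ d \<le> p x0" using x0(2) by metis
    then show ?thesis using pos by (simp add: pos_divide_le_eq)
  qed
  show thesis
  proof (rule that[OF x0_open])
    fix u
    define F where "F = (\<lambda>s. p (x0 + s *\<^sub>R u) - p x0 * blinfun_apply \<xi> (x0 + s *\<^sub>R u) ^ d)"
    have deriv: "(F has_real_derivative directional_deriv p u x0 - p x0 * (real d * blinfun_apply \<xi> u)) (at 0)"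
      unfolding F_def blinfun.add_right blinfun.scaleR_right
      using DERIV_p_line[of x0 u 0] \<open>blinfun_apply \<xi> x0 = 1\<close>
      by (auto intro!: derivative_eq_intros)
    define N where "N = {s. x0 + s *\<^sub>R u \<in> open_hcone \<and> blinfun_apply \<xi> (x0 + s *\<^sub>R u) > 0}"
    have "open N"
    proof -
      have "N = (\<lambda>s. x0 + s *\<^sub>R u) -` open_hcone \<inter> {s. blinfun_apply \<xi> (x0 + s *\<^sub>R u) > 0}"
        by (auto simp: N_def)
      then show ?thesis
        by (auto intro!: open_Int open_vimage open_open_hcone open_Collect_less continuous_intros)
    qed
    moreover have "0 \<in> N" using x0_open \<open>blinfun_apply \<xi> x0 = 1\<close> by (simp add: N_def)
    ultimately obtain \<delta> where \<delta>: "\<delta> > 0" "ball 0 \<delta> \<subseteq> N" by (auto simp: open_contains_ball)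
    have max_F: "F s \<le> F 0" if "\<bar>0 - s\<bar> < \<delta>" for s
    proof -
      have "s \<in> N" using \<delta> that by (auto simp: dist_norm)
      then have "F s \<le> 0" using max[of "x0 + s *\<^sub>R u"] open_hcone_subset by (auto simp: N_def F_def)
      then show ?thesis using \<open>blinfun_apply \<xi> x0 = 1\<close> by (simp add: F_def)
    qed
    have "directional_deriv p u x0 - p x0 * (real d * blinfun_apply \<xi> u) = 0"
      by (rule DERIV_local_max[OF deriv \<delta>(1)]) (use max_F in blast)
    then show "directional_deriv p u x0 = p x0 * (real d * blinfun_apply \<xi> u)" by simp
  qed
qed

lemma hcone_degree_0:
  assumes "d = 0"
  shows "hcone = UNIV"
proof -
  have const: "p x = p 0" for x using p_scale[of 0 x] assms by simp
  have "p x \<noteq> 0" for x using const[of x] const[of e] p_e_pos by simp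
  then show ?thesis by (auto simp: mem_hcone_iff)
qed

lemma rel_interior_dual_cone_subset:
  assumes "\<xi> \<in> rel_interior (dual_cone hcone)"
  obtains x y where "y \<in> carrier_vec d" "hermite_functional d p e x y = \<xi>"
proof (cases "d = 0")
  case True
  have zero: "\<eta> = 0" if "\<eta> \<in> dual_cone hcone" for \<eta>
  proof (rule blinfun_eqI)
    fix x
    have "blinfun_apply \<eta> x \<ge> 0" "blinfun_apply \<eta> (- x) \<ge> 0"
      using that by (auto simp: dual_cone_def hcone_degree_0[OF True])
    then show "blinfun_apply \<eta> x = blinfun_apply 0 x" by (simp add: blinfun.minus_right)
  qed
  have y: "0\<^sub>v d \<in> carrier_vec d" by simp
  have "\<xi> = 0" using assms rel_interior_subset zero by blast
  then show thesis
    using that[OF y] zero[OF hermite_functional_in_dual_cone[OF y]] by simp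
next
  case False
  then have "d > 0" by simp
  from rel_interior_dual_cone_gradient[OF this assms] obtain x where
    x: "x \<in> open_hcone" "\<And>u. directional_deriv p u x = p x * (real d * blinfun_apply \<xi> u)" by blast
  from gradient_in_hermite_image[OF \<open>d > 0\<close> x] that show thesis by metis
qed

end

theorem theorem7p2:
  fixes p :: "real ^ 'n \<Rightarrow> real" and e :: "real ^ 'n" and d :: nat
  assumes "p \<in> hyperbolic_polys d e"
  shows "rel_interior (dual_cone (hyperbolicity_cone p e))
           \<subseteq> {hermite_functional d p e x y | x y. y \<in> carrier_vec d}
       \<and> {hermite_functional d p e x y | x y. y \<in> carrier_vec d}
           \<subseteq> dual_cone (hyperbolicity_cone p e)"
proof -
  from assms obtain c where "\<And>x. p x = form of_real d c (vec_nth x)"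
    unfolding hyperbolic_polys_def homogeneous_poly_def form_def by auto
  then interpret hyperbolic_form p d e c
    by unfold_locales (use assms in \<open>auto simp: hyperbolic_polys_def\<close>)
  show ?thesis
    using rel_interior_dual_cone_subset hermite_functional_in_dual_cone by blast
qed

end
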